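(* Let $\mathcal{A}:\mathbb{R}^{m\times n}\to\mathbb{R}^{d}$ be a linear map and $b\in\mathbb{R}^{d}$. Let $X_{0}$ be an optimal solution of (AMRM): $\min_{X\in\mathbb{R}^{m\times n}}\operatorname{rank}(X)$ s.t. $\mathcal{A}(X)=b$, with $\operatorname{rank}(X_0)=T\ge 1$. Suppose there is an integer $K>2T$ such that $$\frac{K}{2T}\bigl(1-\delta_{2T+K}(\mathcal{A})\bigr)-\bigl(1+\delta_{K}(\mathcal{A})\bigr)>0 .$$ Then there exists $a^{\ast}>1$ (depending on $\delta_{K}(\mathcal{A})$ and $\delta_{2T+K}(\mathcal{A})$) such that for every $a$ with $1<a<a^{\ast}$, every optimal solution $X^{\ast}$ of (TrAMRM): $\min_{X\in\mathbb{R}^{m\times n}}P_{a}(X)$ s.t. $\mathcal{A}(X)=b$, satisfies $X^{\ast}=X_{0}$.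
   Context: Throughout $m\le n$. For $X\in\mathbb{R}^{m\times n}$, $\sigma_1(X)\ge\dots\ge\sigma_m(X)\ge 0$ are its singular values, and for $a>0$, $P_a(X)=\sum_{i=1}^{m}\frac{a\sigma_i(X)}{a\sigma_i(X)+1}$. For an integer $r$ with $1\le r\le m$, the $r$-restricted isometry constant $\delta_r(\mathcal{A})$ is the smallest number such that $(1-\delta_r(\mathcal{A}))\|X\|_F^2\le\|\mathcal{A}(X)\|_2^2\le(1+\delta_r(\mathcal{A}))\|X\|_F^2$ for all $X\in\mathbb{R}^{m\times n}$ of rank at most $r$. It is understood that $2T+K\le m$, so that $\delta_K(\mathcal{A})$ and $\delta_{2T+K}(\mathcal{A})$ are defined. *)

theory Defs
  imports "HOL-Analysis.Analysis" "HOL-Computational_Algebra.Computational_Algebra"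
begin

definition charpoly :: "real ^ 'n ^ 'n \<Rightarrow> real poly" where
  "charpoly A = det (mat [:0, 1:] - map_matrix (\<lambda>c. [:c:]) A)"

text \<open>
  The singular values of an \<open>m \<times> n\<close> matrix \<open>X\<close> with \<open>m \<le> n\<close> are the square roots of the \<open>m\<close>
  eigenvalues of \<open>X X\<^sup>T\<close>, counted with multiplicity as roots of the characteristic polynomial.
  As \<open>X X\<^sup>T\<close> is positive semidefinite, all these roots are real and nonnegative.
\<close>

definition singular_values :: "real ^ 'n ^ 'm \<Rightarrow> real list" where
  "singular_values X =
     rev (sorted_list_of_multiset (image_mset sqrt (proots (charpoly (X ** transpose X)))))"

text \<open>As usual in mathematics, the index \<open>i\<close> ranges over \<open>1, \<dots>, m\<close>.\<close>

definition singular_value :: "nat \<Rightarrow> real ^ 'n ^ 'm \<Rightarrow> real" where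
  "singular_value i X = singular_values X ! (i - 1)"

definition frac_penalty :: "real \<Rightarrow> real ^ 'n ^ 'm \<Rightarrow> real" where
  "frac_penalty a X = (\<Sum>i = 1..CARD('m). a * singular_value i X / (a * singular_value i X + 1))"

text \<open>
  The library norm on \<^typ>\<open>real ^ 'n ^ 'm\<close> is the Euclidean norm of the vector of
  Euclidean norms of its rows, i.e. the Frobenius norm.
\<close>

definition restricted_isometry_const :: "(real ^ 'n ^ 'm \<Rightarrow> real ^ 'd) \<Rightarrow> nat \<Rightarrow> real" where
  "restricted_isometry_const \<A> r =
     (LEAST \<delta>. \<forall>X. rank X \<le> r \<longrightarrow>
        (1 - \<delta>) * (norm X)\<^sup>2 \<le> (norm (\<A> X))\<^sup>2 \<and> (norm (\<A> X))\<^sup>2 \<le> (1 + \<delta>) * (norm X)\<^sup>2)"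

end

theory Submission
  imports Defs
begin

text \<open>
  The threshold \<open>a\<^sup>* = 2\<close> works, and in fact every \<open>a > 0\<close> recovers \<open>X\<^sub>0\<close>. Put \<open>Z = X\<^sup>* - X\<^sub>0\<close>, which
  lies in the kernel of \<open>\<A>\<close>, write \<open>f t = a t / (a t + 1)\<close>, and let \<open>Q\<close> project onto the row space
  of \<open>X\<^sub>0\<close>. Subadditivity of the penalty (Rotfel'd) applied to \<open>X\<^sub>0 = (X\<^sub>0 + Z) Q - Z Q\<close> bounds
  \<open>P\<^sub>a X\<^sub>0\<close> by the first \<open>T\<close> terms of \<open>P\<^sub>a (X\<^sub>0 + Z)\<close> and \<open>P\<^sub>a Z\<close>, while Weyl's inequality
  \<open>\<sigma>\<^bsub>i+T\<^esub> Z \<le> \<sigma>\<^sub>i (X\<^sub>0 + Z)\<close> bounds the remaining terms of \<open>P\<^sub>a (X\<^sub>0 + Z)\<close> from below. Minimality of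
  \<open>X\<^sup>*\<close> then gives \<open>\<Sum>i>2T. f (\<sigma>\<^sub>i Z) \<le> \<Sum>i\<le>T. f (\<sigma>\<^sub>i Z)\<close>, and concavity turns this into
  \<open>\<Sum>i>2T. \<sigma>\<^sub>i Z \<le> \<Sum>i\<le>2T. \<sigma>\<^sub>i Z\<close>. Cutting the singular value decomposition of \<open>Z\<close> into a head of
  \<open>2T + K\<close> terms and blocks of \<open>K\<close> terms, the restricted isometry bounds force the head to vanish.
\<close>

section \<open>Orthonormal eigenbases\<close>

text \<open>Compactness gives a maximiser \<open>v\<close> of the Rayleigh quotient on the unit
  sphere of \<open>S\<close>. The residual \<open>w = f v - l v\<close> lies in \<open>S\<close> and
  is orthogonal to \<open>v\<close>; moving from \<open>v\<close> along \<open>w\<close> would raise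
  the quotient to first order unless \<open>w = 0\<close>.\<close>

lemma unit_eigenvector_in_invariant_subspace:
  fixes f :: "'a::euclidean_space \<Rightarrow> 'a"
  assumes f: "linear f" and sa: "\<And>x y. f x \<bullet> y = x \<bullet> f y"
    and S: "subspace S" "f ` S \<subseteq> S" "S \<noteq> {0}"
  obtains v where "v \<in> S" "norm v = 1" "f v = (v \<bullet> f v) *\<^sub>R v"
proof -
  define C where "C = S \<inter> sphere 0 1"
  have "compact C"
    unfolding C_def using S(1) by (intro closed_Int_compact closed_subspace compact_sphere)
  moreover have "C \<noteq> {}"
  proof -
    obtain x where x: "x \<in> S" "x \<noteq> 0"
      using S(1,3) subspace_0 by blast
    then have "(1 / norm x) *\<^sub>R x \<in> C"
      using S(1) by (auto simp: C_def subspace_mul)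
    then show ?thesis by blast
  qed
  moreover have "continuous_on C (\<lambda>x. x \<bullet> f x)"
    using f by (intro continuous_intros linear_continuous_on linear_conv_bounded_linear[THEN iffD1])
  ultimately obtain v where v: "v \<in> C" and max: "\<And>x. x \<in> C \<Longrightarrow> x \<bullet> f x \<le> v \<bullet> f v"
    by (metis continuous_attains_sup)
  define l where "l = v \<bullet> f v"
  have vS: "v \<in> S" and nv: "v \<bullet> v = 1" "norm v = 1"
    using v by (auto simp: C_def norm_eq_1)
  have bound: "x \<bullet> f x \<le> l * (x \<bullet> x)" if "x \<in> S" for x
  proof (cases "x = 0")
    case True
    then show ?thesis by simp
  next
    case False
    have "(1 / norm x) *\<^sub>R x \<in> C"
      using False that S(1) by (auto simp: C_def subspace_mul)
    from max[OF this] have "(x \<bullet> f x) / (norm x)\<^sup>2 \<le> l"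
      by (simp add: linear_cmul[OF f] l_def power2_eq_square field_simps)
    then show ?thesis
      using False by (simp add: field_simps dot_square_norm)
  qed
  define w where "w = f v - l *\<^sub>R v"
  have wS: "w \<in> S"
    unfolding w_def using S(1,2) vS by (auto intro!: subspace_diff subspace_mul)
  have vw: "v \<bullet> w = 0"
    by (simp add: w_def inner_diff_right nv l_def)
  have fw: "f v \<bullet> w = w \<bullet> w"
    using vw by (simp add: w_def inner_diff_left inner_diff_right inner_commute)
  \<comment> \<open>This is \<open>bound\<close> at \<open>v + t w\<close>: the left side is the
    first-order gain, the right side the second-order correction.\<close>
  have quad: "2 * t * (w \<bullet> w) \<le> t\<^sup>2 * (l * (w \<bullet> w) - w \<bullet> f w)" for t
  proof -
    have "v + t *\<^sub>R w \<in> S"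
      using S(1) vS wS by (auto intro!: subspace_add subspace_mul)
    from bound[OF this] show ?thesis
      using vw fw sa[of v w]
      by (simp add: linear_add[OF f] linear_cmul[OF f] inner_add_left inner_add_right nv
          l_def[symmetric] power2_eq_square algebra_simps inner_commute)
  qed
  have "w \<bullet> w = 0"
  proof (rule ccontr)
    assume "w \<bullet> w \<noteq> 0"
    then have pos: "w \<bullet> w > 0"
      by (metis inner_ge_zero less_eq_real_def)
    define d where "d = l * (w \<bullet> w) - w \<bullet> f w"
    \<comment> \<open>Chosen so that \<open>t * (\<bar>d\<bar> + 1) = w \<bullet> w\<close>, which
      \<open>quad\<close> would force to be at least twice itself.\<close>
    define t where "t = (w \<bullet> w) / (\<bar>d\<bar> + 1)"
    have t: "t > 0" using pos by (simp add: t_def add_nonneg_pos)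
    have "2 * (w \<bullet> w) \<le> t * d"
      using quad[of t] t by (simp add: power2_eq_square d_def)
    also have "\<dots> \<le> t * (\<bar>d\<bar> + 1)"
      using t by (intro mult_left_mono) auto
    also have "\<dots> = w \<bullet> w"
      by (simp add: t_def add_nonneg_pos field_simps)
    finally show False using pos by simp
  qed
  then have "f v = (v \<bullet> f v) *\<^sub>R v"
    by (simp add: w_def l_def)
  with that vS nv(2) show thesis by blast
qed

text \<open>Since \<open>f\<close> is symmetric, the orthogonal complement of the eigenvectors found
  so far is invariant; it is nonzero as long as there are fewer than \<open>DIM('a)\<close> of them,
  so it contains a further unit eigenvector.\<close>

lemma orthonormal_eigenvectors:
  fixes f :: "'a::euclidean_space \<Rightarrow> 'a"
  assumes f: "linear f" and sa: "\<And>x y. f x \<bullet> y = x \<bullet> f y"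
    and "n \<le> DIM('a)"
  shows "\<exists>B. finite B \<and> card B = n \<and> pairwise orthogonal B \<and>
    (\<forall>v\<in>B. norm v = 1 \<and> f v = (v \<bullet> f v) *\<^sub>R v)"
  using \<open>n \<le> DIM('a)\<close>
proof (induction n)
  case 0
  show ?case by (rule exI[of _ "{}"]) auto
next
  case (Suc n)
  then obtain B where B: "finite B" "card B = n" "pairwise orthogonal B"
    and ev: "\<And>v. v \<in> B \<Longrightarrow> norm v = 1 \<and> f v = (v \<bullet> f v) *\<^sub>R v"
    by (metis Suc_leD)
  define S where "S = {y. \<forall>x\<in>span B. orthogonal x y}"
  have S: "subspace S"
    unfolding S_def by (rule subspace_orthogonal_to_vectors)
  have "dim S + dim (span B) = DIM('a)"
    using dim_subspace_orthogonal_to_vectors[of "span B" UNIV] by (simp add: S_def)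
  moreover have "dim (span B) \<le> n"
    using B dim_le_card'[of B] by simp
  ultimately have "S \<noteq> {0}"
    using Suc.prems by auto
  moreover have "f ` S \<subseteq> S"
  proof clarify
    fix y assume y: "y \<in> S"
    have "orthogonal (f y) x" if "x \<in> B" for x
    proof -
      have "f y \<bullet> x = (x \<bullet> f x) * (y \<bullet> x)"
        using ev[OF that] sa[of y x] by (metis inner_scaleR_right)
      moreover have "x \<bullet> y = 0"
        using y that by (auto simp: S_def orthogonal_def span_base)
      ultimately show ?thesis by (simp add: orthogonal_def inner_commute)
    qed
    then have "orthogonal (f y) x" if "x \<in> span B" for x
      using orthogonal_to_span that by blast
    then show "f y \<in> S" by (simp add: S_def orthogonal_commute)
  qed
  ultimately obtain v where v: "v \<in> S" "norm v = 1" "f v = (v \<bullet> f v) *\<^sub>R v"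
    using unit_eigenvector_in_invariant_subspace[OF f sa S] by blast
  have orth: "orthogonal x v" if "x \<in> B" for x
    using v(1) that by (auto simp: S_def span_base)
  then have "v \<notin> B"
    using v(2) by (force simp: orthogonal_self)
  then have "card (insert v B) = Suc n" "finite (insert v B)"
    using B by auto
  moreover have "pairwise orthogonal (insert v B)"
    using B(3) orth by (auto simp: pairwise_insert orthogonal_commute)
  ultimately show ?case
    using ev v by (intro exI[of _ "insert v B"]) auto
qed

text \<open>Indexing by natural numbers lets a basis be listed in the order of its eigenvalues. Only
  indices below the dimension are constrained, and that many orthonormal vectors already form a
  basis.\<close>

definition orthonormal_seq :: "(nat \<Rightarrow> 'a::euclidean_space) \<Rightarrow> bool" where
  "orthonormal_seq u \<longleftrightarrow>
     (\<forall>i<DIM('a). \<forall>j<DIM('a). u i \<bullet> u j = (if i = j then 1 else 0))"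

lemma orthonormal_seqD:
  fixes u :: "nat \<Rightarrow> 'a::euclidean_space"
  assumes "orthonormal_seq u" "i < DIM('a)" "j < DIM('a)"
  shows "u i \<bullet> u j = (if i = j then 1 else 0)"
  using assms by (auto simp: orthonormal_seq_def)

lemma orthonormal_seq_independent:
  fixes u :: "nat \<Rightarrow> 'a::euclidean_space"
  assumes u: "orthonormal_seq u" and I: "I \<subseteq> {..<DIM('a)}"
  shows "independent (u ` I)" "dim (span (u ` I)) = card I"
proof -
  have inj: "inj_on u I"
  proof (rule inj_onI)
    fix i j assume "i \<in> I" "j \<in> I" "u i = u j"
    then show "i = j"
      using orthonormal_seqD[OF u, of i j] orthonormal_seqD[OF u, of i i] I
      by (metis in_mono lessThan_iff zero_neq_one)
  qed
  have "pairwise orthogonal (u ` I)"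
  proof (clarsimp simp: pairwise_def orthogonal_def)
    fix i j assume "i \<in> I" "j \<in> I" "u i \<noteq> u j"
    then show "u i \<bullet> u j = 0"
      using orthonormal_seqD[OF u, of i j] I by (cases "i = j") auto
  qed
  moreover have "0 \<notin> u ` I"
  proof
    assume "0 \<in> u ` I"
    then obtain i where "i \<in> I" "u i = 0" by auto
    then show False
      using orthonormal_seqD[OF u, of i i] I by auto
  qed
  ultimately show ind: "independent (u ` I)"
    by (rule pairwise_orthogonal_independent)
  show "dim (span (u ` I)) = card I"
    using ind inj by (simp add: dim_span dim_eq_card_independent card_image)
qed

lemma orthonormal_seq_expand:
  fixes u :: "nat \<Rightarrow> 'a::euclidean_space"
  assumes u: "orthonormal_seq u"
  shows "(\<Sum>i<DIM('a). (u i \<bullet> x) *\<^sub>R u i) = x"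
proof -
  have "x \<in> span (u ` {..<DIM('a)})"
  proof -
    have "span (u ` {..<DIM('a)}) = UNIV"
      using orthonormal_seq_independent(2)[OF u, of "{..<DIM('a)}"]
      by (metis card_lessThan dim_eq_full dim_span span_span subset_refl)
    then show ?thesis by simp
  qed
  then show ?thesis
  proof (induction rule: span_induct_alt)
    case base
    then show ?case by simp
  next
    case (step c y z)
    then obtain j where j: "j < DIM('a)" "y = u j" by auto
    have "(\<Sum>i<DIM('a). (u i \<bullet> u j) *\<^sub>R u i) = (\<Sum>i<DIM('a). if i = j then u j else 0)"
      using orthonormal_seqD[OF u _ j(1)] by (intro sum.cong) auto
    also have "\<dots> = u j" using j by simp
    finally have "(\<Sum>i<DIM('a). (u i \<bullet> y) *\<^sub>R u i) = y" using j by simp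
    moreover have "(\<Sum>i<DIM('a). (u i \<bullet> (c *\<^sub>R y + z)) *\<^sub>R u i)
      = c *\<^sub>R (\<Sum>i<DIM('a). (u i \<bullet> y) *\<^sub>R u i) + (\<Sum>i<DIM('a). (u i \<bullet> z) *\<^sub>R u i)"
      by (simp add: inner_add_right scaleR_add_left sum.distrib scaleR_sum_right)
    ultimately show ?case using step by simp
  qed
qed

lemma orthonormal_seq_inner:
  fixes u :: "nat \<Rightarrow> 'a::euclidean_space"
  assumes u: "orthonormal_seq u"
  shows "(\<Sum>i<DIM('a). (u i \<bullet> x) * (u i \<bullet> y)) = x \<bullet> y"
proof -
  have "x \<bullet> y = (\<Sum>i<DIM('a). (u i \<bullet> x) *\<^sub>R u i) \<bullet> y"
    by (simp add: orthonormal_seq_expand[OF u])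
  then show ?thesis by (simp add: inner_sum_left)
qed

lemma orthonormal_eigenbasis:
  fixes f :: "'a::euclidean_space \<Rightarrow> 'a"
  assumes f: "linear f" and sa: "\<And>x y. f x \<bullet> y = x \<bullet> f y"
  obtains u where "orthonormal_seq u"
    "\<And>i. i < DIM('a) \<Longrightarrow> f (u i) = (u i \<bullet> f (u i)) *\<^sub>R u i"
    "\<And>i j. i \<le> j \<Longrightarrow> j < DIM('a) \<Longrightarrow> u j \<bullet> f (u j) \<le> u i \<bullet> f (u i)"
proof -
  obtain B where B: "finite B" "card B = DIM('a)" "pairwise orthogonal B"
    and ev: "\<And>v. v \<in> B \<Longrightarrow> norm v = 1 \<and> f v = (v \<bullet> f v) *\<^sub>R v"
    using orthonormal_eigenvectors[OF f sa order_refl] by blast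
  obtain bs where bs: "set bs = B" "distinct bs"
    using finite_distinct_list[OF B(1)] by blast
  \<comment> \<open>The negated key turns ascending sorting into decreasing eigenvalues.\<close>
  define us where "us = sort_key (\<lambda>v. - (v \<bullet> f v)) bs"
  have us: "set us = B" "distinct us" "length us = DIM('a)"
    using bs B(2) by (auto simp: us_def distinct_card[symmetric])
  have nth: "us ! i \<in> B" if "i < DIM('a)" for i
    using us that nth_mem by metis
  have "sorted (map (\<lambda>v. - (v \<bullet> f v)) us)"
    by (simp add: us_def)
  then have "us ! j \<bullet> f (us ! j) \<le> us ! i \<bullet> f (us ! i)"
    if "i \<le> j" "j < DIM('a)" for i j
    using that us(3) by (auto simp: sorted_iff_nth_mono)
  moreover have "orthonormal_seq (\<lambda>i. us ! i)"
    unfolding orthonormal_seq_def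
  proof (intro allI impI)
    fix i j assume ij: "i < DIM('a)" "j < DIM('a)"
    show "us ! i \<bullet> us ! j = (if i = j then 1 else 0)"
    proof (cases "i = j")
      case True
      then show ?thesis using ev[OF nth[OF ij(1)]] by (simp add: norm_eq_1)
    next
      case False
      then have "us ! i \<noteq> us ! j"
        using us ij by (simp add: nth_eq_iff_index_eq)
      then show ?thesis
        using False B(3) nth[OF ij(1)] nth[OF ij(2)] by (auto simp: pairwise_def orthogonal_def)
    qed
  qed
  ultimately show thesis
    using that[of "\<lambda>i. us ! i"] ev nth by blast
qed

section \<open>Singular values\<close>

lemma map_matrix_pCons_mult:
  fixes A :: "real ^ 'n ^ 'm" and B :: "real ^ 'k ^ 'n"
  shows "map_matrix (\<lambda>c. [:c:]) (A ** B) = map_matrix (\<lambda>c. [:c:]) A ** map_matrix (\<lambda>c. [:c:]) B"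
proof -
  have "(\<Sum>k\<in>I. [:g k:]) = [:sum g I:]" for g :: "'n \<Rightarrow> real" and I
    by (induction I rule: infinite_finite_induct) auto
  then show ?thesis
    by (simp add: vec_eq_iff matrix_matrix_mult_def mult.commute)
qed

lemma map_matrix_pCons_mat: "map_matrix (\<lambda>c. [:c:]) (mat c :: real ^ 'n ^ 'n) = mat [:c:]"
  by (simp add: vec_eq_iff mat_def)

lemma mat_mult_commute: "mat c ** A = A ** mat (c :: 'a::comm_semiring_1)"
  by (simp add: vec_eq_iff matrix_matrix_mult_def mat_def if_distrib if_distribR mult.commute cong: if_cong)

lemma matrix_diff_ldistrib: "A ** (B - C) = A ** B - A ** C" for A :: "'a::ring_1 ^ 'n ^ 'm"
  by (simp add: vec_eq_iff matrix_matrix_mult_def algebra_simps sum_subtractf)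

lemma matrix_diff_rdistrib: "(B - C) ** D = B ** D - C ** D" for D :: "'a::ring_1 ^ 'k ^ 'n"
  by (simp add: vec_eq_iff matrix_matrix_mult_def algebra_simps sum_subtractf)

text \<open>The scalar matrix \<open>mat [:0, 1:]\<close> commutes with every matrix, so conjugating
  \<open>A\<close> conjugates the whole polynomial matrix, and the determinants of \<open>P\<close>
  and \<open>R\<close> cancel.\<close>

lemma charpoly_similar:
  fixes A P R :: "real ^ 'n ^ 'n"
  assumes "R ** P = mat 1"
  shows "charpoly (P ** A ** R) = charpoly A"
proof -
  let ?c = "map_matrix (\<lambda>c::real. [:c:])"
  have PR: "P ** R = mat 1"
    using assms matrix_left_right_inverse by blast
  have 1: "?c P ** ?c R = mat 1"
    by (metis PR map_matrix_pCons_mult map_matrix_pCons_mat one_pCons)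
  have "mat [:0, 1:] - ?c (P ** A ** R) = ?c P ** (mat [:0, 1:] - ?c A) ** ?c R"
  proof -
    have "?c P ** mat [:0, 1:] ** ?c R = mat [:0, 1:]"
      using 1 by (metis mat_mult_commute matrix_mul_assoc matrix_mul_rid)
    then show ?thesis
      by (simp add: map_matrix_pCons_mult matrix_diff_ldistrib matrix_diff_rdistrib)
  qed
  then have "charpoly (P ** A ** R) = det (?c P) * charpoly A * det (?c R)"
    by (simp add: charpoly_def det_mul)
  also have "\<dots> = det (?c P ** ?c R) * charpoly A"
    by (simp add: det_mul)
  finally show ?thesis by (simp add: 1 det_I)
qed

text \<open>The matrix \<open>P\<close> with rows \<open>u (e k)\<close> is orthogonal and turns
  \<open>A\<close> into a diagonal matrix. The bijection \<open>e\<close> is needed because rows are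
  indexed by the type \<open>'m\<close> and the basis by numbers.\<close>

lemma charpoly_eigenbasis:
  fixes A :: "real ^ 'm ^ 'm"
  assumes u: "orthonormal_seq u" and ev: "\<And>i. i < CARD('m) \<Longrightarrow> A *v u i = l i *\<^sub>R u i"
  shows "charpoly A = (\<Prod>i<CARD('m). [:- l i, 1:])"
proof -
  obtain e :: "'m \<Rightarrow> nat" where e: "bij_betw e UNIV {..<CARD('m)}"
    by (metis atLeast0LessThan ex_bij_betw_finite_nat finite_class.finite_UNIV)
  have lt: "e k < CARD('m)" for k
    using e by (auto simp: bij_betw_def)
  have inj: "e j = e k \<longleftrightarrow> j = k" for j k
    using e by (auto simp: bij_betw_def inj_on_def)
  define P :: "real ^ 'm ^ 'm" where "P = (\<chi> k. u (e k))"
  have P: "P $ k $ i = u (e k) $ i" for k i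
    by (simp add: P_def)
  have PP: "(P ** B ** transpose P) $ j $ k = u (e j) \<bullet> (B *v u (e k))" for B j k
  proof -
    have "(P ** B ** transpose P) $ j $ k = (P ** (B ** transpose P)) $ j $ k"
      by (simp add: matrix_mul_assoc)
    also have "\<dots> = u (e j) \<bullet> column k (B ** transpose P)"
      by (simp add: matrix_matrix_mult_def[of P] inner_vec_def column_def P)
    also have "column k (B ** transpose P) = B *v u (e k)"
      by (simp add: vec_eq_iff column_def matrix_matrix_mult_def matrix_vector_mult_def
          transpose_def P)
    finally show ?thesis .
  qed
  have ort: "u (e j) \<bullet> u (e k) = (if j = k then 1 else 0)" for j k
    using orthonormal_seqD[OF u, of "e j" "e k"] lt inj by simp
  have "(P ** transpose P) $ j $ k = (if j = k then 1 else 0)" for j k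
    using PP[of "mat 1" j k] ort by simp
  then have "P ** transpose P = mat 1"
    by (simp add: vec_eq_iff mat_def)
  then have "charpoly A = charpoly (P ** A ** transpose P)"
    using charpoly_similar matrix_left_right_inverse by metis
  also have "\<dots> = (\<Prod>k\<in>UNIV. [:- l (e k), 1:])"
  proof -
    let ?M = "mat [:0, 1:] - map_matrix (\<lambda>c. [:c:]) (P ** A ** transpose P)"
    have M: "?M $ j $ k = (if j = k then [:- l (e k), 1:] else 0)" for j k
      using lt ort by (simp add: mat_def PP ev)
    then have "det ?M = (\<Prod>k\<in>UNIV. ?M $ k $ k)"
      by (intro det_diagonal) (simp only: M if_False)
    also have "\<dots> = (\<Prod>k\<in>UNIV. [:- l (e k), 1:])"
      by (intro prod.cong refl) (simp only: M refl if_True)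
    finally show ?thesis by (simp add: charpoly_def)
  qed
  also have "\<dots> = (\<Prod>i<CARD('m). [:- l i, 1:])"
    using prod.reindex_bij_betw[OF e] .
  finally show ?thesis .
qed

lemma proots_prod_linear_factors: "proots (\<Prod>i\<in>I. [:- l i, 1:]) = image_mset l (mset_set I)"
  for l :: "'b \<Rightarrow> 'a::idom"
proof (induction I rule: infinite_finite_induct)
  case (insert x F)
  have "(\<Prod>i\<in>F. [:- l i, 1:]) \<noteq> 0"
    using insert(1) by (simp add: prod_zero_iff)
  with insert show ?case
    by (simp add: proots_mult del: mult_pCons_left)
qed auto

text \<open>Links the roots of the characteristic polynomial to vectors. For an eigenbasis
  \<open>u\<close> of \<open>A = X ** transpose X\<close>, the form
  \<open>(A *v x) \<bullet> y\<close> equals the inner product of \<open>x v* X\<close> and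
  \<open>y v* X\<close>, so the images \<open>u i v* X\<close> are orthogonal and their squared
  norms are the eigenvalues.\<close>

lemma left_singular_basis_singular_values:
  fixes X :: "real ^ 'n ^ 'm"
  shows "\<exists>u. orthonormal_seq u \<and>
     singular_values X = map (\<lambda>i. norm (u i v* X)) [0..<CARD('m)] \<and>
     (\<forall>i<CARD('m). \<forall>j<CARD('m). i \<noteq> j \<longrightarrow> (u i v* X) \<bullet> (u j v* X) = 0) \<and>
     (\<forall>i j. i \<le> j \<longrightarrow> j < CARD('m) \<longrightarrow> norm (u j v* X) \<le> norm (u i v* X))"
proof -
  define A where "A = X ** transpose X"
  have form: "(A *v x) \<bullet> y = (x v* X) \<bullet> (y v* X)" for x y
  proof -
    have "A *v x = X *v (x v* X)"
      by (metis A_def matrix_vector_mul_assoc transpose_matrix_vector)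
    then show ?thesis by (metis dot_lmul_matrix inner_commute)
  qed
  obtain u where u: "orthonormal_seq u"
    and ev: "\<And>i. i < CARD('m) \<Longrightarrow> A *v u i = (u i \<bullet> (A *v u i)) *\<^sub>R u i"
    and dec: "\<And>i j. i \<le> j \<Longrightarrow> j < CARD('m) \<Longrightarrow> u j \<bullet> (A *v u j) \<le> u i \<bullet> (A *v u i)"
  proof (rule orthonormal_eigenbasis[of "(*v) A"])
    show "(A *v x) \<bullet> y = x \<bullet> (A *v y)" for x y
      using form by (metis inner_commute)
  qed auto
  define l where "l i = u i \<bullet> (A *v u i)" for i
  have l: "l i = (norm (u i v* X))\<^sup>2" for i
    using form[of "u i" "u i"] by (simp add: l_def inner_commute dot_square_norm)
  have "charpoly A = (\<Prod>i<CARD('m). [:- l i, 1:])"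
    using charpoly_eigenbasis[OF u, of A l] ev by (simp add: l_def)
  then have "image_mset sqrt (proots (charpoly A))
      = image_mset (\<lambda>i. norm (u i v* X)) (mset_set {..<CARD('m)})"
    by (simp add: proots_prod_linear_factors image_mset.compositionality o_def l)
  also have "\<dots> = mset (rev (map (\<lambda>i. norm (u i v* X)) [0..<CARD('m)]))"
    by (simp add: atLeast0LessThan)
  finally have ms: "image_mset sqrt (proots (charpoly A)) = \<dots>" .
  have dec': "norm (u j v* X) \<le> norm (u i v* X)" if "i \<le> j" "j < CARD('m)" for i j
    using dec[OF that] l by (simp add: l_def)
  \<comment> \<open>An ascending list is determined by its multiset, so this reversed list is the
    one that \<open>singular_values\<close> reverses back.\<close>
  then have "sorted (rev (map (\<lambda>i. norm (u i v* X)) [0..<CARD('m)]))"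
    by (auto simp: sorted_rev_iff_nth_mono)
  then have "singular_values X = map (\<lambda>i. norm (u i v* X)) [0..<CARD('m)]"
    by (simp add: singular_values_def ms flip: A_def del: mset_rev mset_map)
       (metis rev_rev_ident rev_map sorted_sort_id)
  moreover have "(u i v* X) \<bullet> (u j v* X) = 0" if "i < CARD('m)" "j < CARD('m)" "i \<noteq> j" for i j
    using form[of "u i" "u j"] ev[OF that(1)] orthonormal_seqD[OF u, of i j] that
    by (metis DIM_cart DIM_real inner_scaleR_left mult.right_neutral mult_zero_right)
  ultimately show ?thesis using u dec' by blast
qed

section \<open>Zero-based indices and the singular value decomposition\<close>

lemma singular_value_Suc: "singular_value (Suc i) X = singular_values X ! i"
  by (simp add: singular_value_def)

lemma frac_penalty_eq:
  fixes X :: "real ^ 'n ^ 'm"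
  shows "frac_penalty a X =
    (\<Sum>i<CARD('m). a * singular_value (Suc i) X / (a * singular_value (Suc i) X + 1))"
  unfolding frac_penalty_def
  using sum.atLeast1_atMost_eq[of "\<lambda>i. a * singular_value i X / (a * singular_value i X + 1)" "CARD('m)"]
  by simp

lemma singular_value_nonneg:
  fixes X :: "real ^ 'n ^ 'm"
  assumes "i < CARD('m)"
  shows "0 \<le> singular_value (Suc i) X"
  using left_singular_basis_singular_values[of X] assms by (auto simp: singular_value_Suc)

lemma singular_value_antimono:
  fixes X :: "real ^ 'n ^ 'm"
  assumes "i \<le> j" "j < CARD('m)"
  shows "singular_value (Suc j) X \<le> singular_value (Suc i) X"
  using left_singular_basis_singular_values[of X] assms by (auto simp: singular_value_Suc)

lemma linear_vector_matrix_mult: "linear (\<lambda>x. x v* X)" for X :: "real ^ 'n ^ 'm"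
  using matrix_vector_mul_linear[of "transpose X"] by simp

lemma left_singular_basis:
  fixes X :: "real ^ 'n ^ 'm"
  obtains u where "orthonormal_seq u"
    "\<And>i j. i < CARD('m) \<Longrightarrow> j < CARD('m) \<Longrightarrow>
       (u i v* X) \<bullet> (u j v* X) = (if i = j then (singular_value (Suc i) X)\<^sup>2 else 0)"
proof -
  obtain u where "orthonormal_seq u"
    and sv: "singular_values X = map (\<lambda>i. norm (u i v* X)) [0..<CARD('m)]"
    and "\<forall>i<CARD('m). \<forall>j<CARD('m). i \<noteq> j \<longrightarrow> (u i v* X) \<bullet> (u j v* X) = 0"
    using left_singular_basis_singular_values[of X] by blast
  then show thesis
    by (intro that[of u]) (auto simp: singular_value_Suc dot_square_norm)
qed

lemma singular_value_decomposition:
  fixes X :: "real ^ 'n ^ 'm"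
  obtains u :: "nat \<Rightarrow> real ^ 'm" and v :: "nat \<Rightarrow> real ^ 'n" where "orthonormal_seq u"
    "\<And>i j. i < CARD('m) \<Longrightarrow> j < CARD('m) \<Longrightarrow>
       v i \<bullet> v j = (if i = j \<and> singular_value (Suc i) X \<noteq> 0 then 1 else 0)"
    "\<And>x. x v* X = (\<Sum>i<CARD('m). (singular_value (Suc i) X * (u i \<bullet> x)) *\<^sub>R v i)"
proof -
  define s where "s i = singular_value (Suc i) X" for i
  obtain u where u: "orthonormal_seq u"
    and uX: "\<And>i j. i < CARD('m) \<Longrightarrow> j < CARD('m) \<Longrightarrow>
       (u i v* X) \<bullet> (u j v* X) = (if i = j then (s i)\<^sup>2 else 0)"
    using left_singular_basis[of X] unfolding s_def by blast
  \<comment> \<open>When \<open>s i = 0\<close>, division by zero makes \<open>v i\<close> the zero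
    vector, so the right singular vectors are not completed to an orthonormal family.\<close>
  define v where "v i = (1 / s i) *\<^sub>R (u i v* X)" for i
  have sv: "s i *\<^sub>R v i = u i v* X" if "i < CARD('m)" for i
    using uX[OF that that] by (cases "s i = 0") (auto simp: v_def)
  have 1: "v i \<bullet> v j = (if i = j \<and> s i \<noteq> 0 then 1 else 0)" if "i < CARD('m)" "j < CARD('m)" for i j
    using uX[OF that] by (auto simp: v_def power2_eq_square)
  have 2: "x v* X = (\<Sum>i<CARD('m). (s i * (u i \<bullet> x)) *\<^sub>R v i)" for x
  proof -
    have "x v* X = (\<Sum>i<DIM(real^'m). (u i \<bullet> x) *\<^sub>R u i) v* X"
      by (simp only: orthonormal_seq_expand[OF u])
    also have "\<dots> = (\<Sum>i<CARD('m). (u i \<bullet> x) *\<^sub>R (u i v* X))"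
      by (simp add: linear_sum[OF linear_vector_matrix_mult] linear_cmul[OF linear_vector_matrix_mult])
    also have "\<dots> = (\<Sum>i<CARD('m). (s i * (u i \<bullet> x)) *\<^sub>R v i)"
      by (intro sum.cong refl) (simp add: mult.commute flip: sv)
    finally show ?thesis .
  qed
  show thesis using that[OF u] 1 2 unfolding s_def by blast
qed

lemma norm_orthogonal_sum_sq:
  fixes v :: "'i \<Rightarrow> 'a::real_inner"
  assumes "finite I" "\<And>i j. i \<in> I \<Longrightarrow> j \<in> I \<Longrightarrow> i \<noteq> j \<Longrightarrow> v i \<bullet> v j = 0"
  shows "(norm (\<Sum>i\<in>I. t i *\<^sub>R v i))\<^sup>2 = (\<Sum>i\<in>I. (t i)\<^sup>2 * (v i \<bullet> v i))"
proof -
  have "(norm (\<Sum>i\<in>I. t i *\<^sub>R v i))\<^sup>2 = (\<Sum>i\<in>I. (norm (t i *\<^sub>R v i))\<^sup>2)"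
    using assms by (intro norm_sum_Pythagorean) (auto simp: pairwise_def orthogonal_def)
  then show ?thesis
    by (simp add: power_mult_distrib dot_square_norm)
qed

lemma norm_vector_matrix_mult_sq:
  fixes X :: "real ^ 'n ^ 'm"
  assumes u: "orthonormal_seq u"
    and uX: "\<And>i j. i < CARD('m) \<Longrightarrow> j < CARD('m) \<Longrightarrow>
       (u i v* X) \<bullet> (u j v* X) = (if i = j then (s i)\<^sup>2 else 0)"
  shows "(norm (x v* X))\<^sup>2 = (\<Sum>i<CARD('m). (u i \<bullet> x)\<^sup>2 * (s i)\<^sup>2)"
proof -
  have "x v* X = (\<Sum>i<DIM(real^'m). (u i \<bullet> x) *\<^sub>R u i) v* X"
    by (simp only: orthonormal_seq_expand[OF u])
  also have "\<dots> = (\<Sum>i<CARD('m). (u i \<bullet> x) *\<^sub>R (u i v* X))"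
    by (simp add: linear_sum[OF linear_vector_matrix_mult] linear_cmul[OF linear_vector_matrix_mult])
  also have "(norm \<dots>)\<^sup>2 = (\<Sum>i<CARD('m). (u i \<bullet> x)\<^sup>2 * ((u i v* X) \<bullet> (u i v* X)))"
    using uX by (intro norm_orthogonal_sum_sq) auto
  finally show ?thesis using uX by simp
qed

section \<open>Dimension counts and Weyl's inequality\<close>

lemma dim_Int_ge:
  fixes S T :: "'a::euclidean_space set"
  assumes "subspace S" "subspace T"
  shows "dim S + dim T \<le> DIM('a) + dim (S \<inter> T)"
proof -
  have "dim {x + y |x y. x \<in> S \<and> y \<in> T} \<le> DIM('a)"
    by (rule dim_subset_UNIV)
  then show ?thesis
    using dim_sums_Int[OF assms] by linarith
qed

lemma orthonormal_seq_span_orthogonal: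
  fixes u :: "nat \<Rightarrow> 'a::euclidean_space"
  assumes u: "orthonormal_seq u" and "x \<in> span (u ` I)" "I \<subseteq> {..<DIM('a)}" "i < DIM('a)" "i \<notin> I"
  shows "u i \<bullet> x = 0"
proof -
  have "orthogonal (u i) y" if "y \<in> u ` I" for y
    using that assms orthonormal_seqD[OF u] by (auto simp: orthogonal_def)
  then show ?thesis
    using orthogonal_to_span[OF assms(2)] by (simp add: orthogonal_def)
qed

text \<open>A Courant--Fischer argument; \<open>d = 0\<close> gives monotonicity of singular values, and taking for
  \<open>V\<close> the left kernel of a matrix gives Weyl's inequality for perturbations of rank at most \<open>d\<close>.\<close>

lemma singular_value_le_on_subspace:
  fixes X :: "real ^ 'n ^ 'm" and Y :: "real ^ 'p ^ 'm"
  assumes V: "subspace V" "CARD('m) \<le> dim V + d"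
    and le: "\<And>x. x \<in> V \<Longrightarrow> norm (x v* X) \<le> norm (x v* Y)"
    and kd: "k + d < CARD('m)"
  shows "singular_value (Suc (k + d)) X \<le> singular_value (Suc k) Y"
proof -
  define m where "m = CARD('m)"
  define s where "s i = singular_value (Suc i) X" for i
  define t where "t i = singular_value (Suc i) Y" for i
  obtain u where u: "orthonormal_seq u"
    and uX: "\<And>i j. i < CARD('m) \<Longrightarrow> j < CARD('m) \<Longrightarrow>
       (u i v* X) \<bullet> (u j v* X) = (if i = j then (s i)\<^sup>2 else 0)"
    using left_singular_basis[of X] unfolding s_def by blast
  obtain w where w: "orthonormal_seq w"
    and wY: "\<And>i j. i < CARD('m) \<Longrightarrow> j < CARD('m) \<Longrightarrow>
       (w i v* Y) \<bullet> (w j v* Y) = (if i = j then (t i)\<^sup>2 else 0)"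
    using left_singular_basis[of Y] unfolding t_def by blast
  \<comment> \<open>On \<open>S\<close> the matrix \<open>X\<close> stretches every vector by at
    least \<open>s (k + d)\<close>; on \<open>R\<close> the matrix \<open>Y\<close> stretches by at
    most \<open>t k\<close>. The dimensions of \<open>S\<close>, \<open>R\<close> and
    \<open>V\<close> sum to more than \<open>2 * m\<close>, so the three share a nonzero vector, on
    which the stretches are compared.\<close>
  define S where "S = span (u ` {..k + d})"
  define R where "R = span (w ` {k..<m})"
  have sub: "subspace S" "subspace R"
    by (auto simp: S_def R_def)
  have IS: "{..k + d} \<subseteq> {..<DIM(real^'m)}" and IR: "{k..<m} \<subseteq> {..<DIM(real^'m)}"
    using kd by (auto simp: m_def)
  have dims: "dim S = k + d + 1" "dim R = m - k"
    using orthonormal_seq_independent(2)[OF u IS] orthonormal_seq_independent(2)[OF w IR]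
    by (simp_all add: S_def R_def)
  have "dim S + dim R \<le> m + dim (S \<inter> R)"
    using dim_Int_ge[OF sub] by (simp add: m_def)
  moreover have "dim (S \<inter> R) + dim V \<le> m + dim (S \<inter> R \<inter> V)"
    using dim_Int_ge[OF subspace_inter[OF sub] V(1)] by (simp add: m_def)
  moreover have "m \<le> dim V + d" "k + d < m"
    using V(2) kd by (simp_all add: m_def)
  ultimately have "0 < dim (S \<inter> R \<inter> V)"
    using dims by linarith
  then obtain x where x: "x \<in> S" "x \<in> R" "x \<in> V" "x \<noteq> 0"
    by (metis dim_eq_0 less_irrefl subsetI singletonI Int_iff)
  have nx: "(norm x)\<^sup>2 = (\<Sum>i<m. (u i \<bullet> x)\<^sup>2)" "(norm x)\<^sup>2 = (\<Sum>i<m. (w i \<bullet> x)\<^sup>2)"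
    using orthonormal_seq_inner[OF u, of x x] orthonormal_seq_inner[OF w, of x x]
    by (simp_all add: m_def power2_norm_eq_inner flip: power2_eq_square)
  have nonneg: "0 \<le> s i" "0 \<le> t i" if "i < m" for i
    using that singular_value_nonneg by (auto simp: s_def t_def m_def)
  have "(s (k + d))\<^sup>2 * (norm x)\<^sup>2 = (\<Sum>i<m. (u i \<bullet> x)\<^sup>2 * (s (k + d))\<^sup>2)"
    by (simp add: nx(1) sum_distrib_left mult.commute)
  also have "\<dots> \<le> (\<Sum>i<m. (u i \<bullet> x)\<^sup>2 * (s i)\<^sup>2)"
  proof (rule sum_mono)
    fix i assume "i \<in> {..<m}"
    then have i: "i < m" by simp
    show "(u i \<bullet> x)\<^sup>2 * (s (k + d))\<^sup>2 \<le> (u i \<bullet> x)\<^sup>2 * (s i)\<^sup>2"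
    proof (cases "i \<le> k + d")
      case True
      then have "s (k + d) \<le> s i"
        using kd singular_value_antimono by (auto simp: s_def)
      then show ?thesis
        using nonneg kd by (intro mult_left_mono power_mono) (auto simp: m_def)
    next
      case False
      then have "u i \<bullet> x = 0"
        using orthonormal_seq_span_orthogonal[OF u _ IS] x(1) i by (auto simp: S_def m_def)
      then show ?thesis by simp
    qed
  qed
  also have "\<dots> = (norm (x v* X))\<^sup>2"
    using norm_vector_matrix_mult_sq[OF u uX] by (simp add: m_def)
  also have "\<dots> \<le> (norm (x v* Y))\<^sup>2"
    using le[OF x(3)] by (simp add: power_mono)
  also have "\<dots> = (\<Sum>i<m. (w i \<bullet> x)\<^sup>2 * (t i)\<^sup>2)"
    using norm_vector_matrix_mult_sq[OF w wY] by (simp add: m_def)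
  also have "\<dots> \<le> (\<Sum>i<m. (w i \<bullet> x)\<^sup>2 * (t k)\<^sup>2)"
  proof (rule sum_mono)
    fix i assume "i \<in> {..<m}"
    then have i: "i < m" by simp
    show "(w i \<bullet> x)\<^sup>2 * (t i)\<^sup>2 \<le> (w i \<bullet> x)\<^sup>2 * (t k)\<^sup>2"
    proof (cases "k \<le> i")
      case True
      then have "t i \<le> t k"
        using i singular_value_antimono by (auto simp: t_def m_def)
      then show ?thesis
        using nonneg i by (intro mult_left_mono power_mono) auto
    next
      case False
      then have "w i \<bullet> x = 0"
        using orthonormal_seq_span_orthogonal[OF w _ IR] x(2) i by (auto simp: R_def m_def)
      then show ?thesis by simp
    qed
  qed
  also have "\<dots> = (t k)\<^sup>2 * (norm x)\<^sup>2"
    by (simp add: nx(2) sum_distrib_left mult.commute)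
  finally have "(s (k + d))\<^sup>2 \<le> (t k)\<^sup>2"
    using x(4) by simp
  then have "s (k + d) \<le> t k"
    using power2_le_imp_le nonneg(2)[of k] kd by (simp add: m_def)
  then show ?thesis by (simp add: s_def t_def)
qed

lemma singular_value_mono:
  fixes X :: "real ^ 'n ^ 'm" and Y :: "real ^ 'p ^ 'm"
  assumes "\<And>x. norm (x v* X) \<le> norm (x v* Y)" "k < CARD('m)"
  shows "singular_value (Suc k) X \<le> singular_value (Suc k) Y"
  using singular_value_le_on_subspace[of UNIV 0 X Y k] assms by simp

lemma subspace_left_kernel: "subspace {x. x v* X = 0}" for X :: "real ^ 'n ^ 'm"
  by (rule linear_subspace_kernel[OF linear_vector_matrix_mult])

text \<open>The left kernel is the orthogonal complement of the column space.\<close>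

lemma dim_left_kernel:
  fixes X :: "real ^ 'n ^ 'm"
  shows "dim {x. x v* X = 0} + rank X = CARD('m)"
proof -
  have "subspace (range ((*v) X))"
    by (rule linear_subspace_image) auto
  moreover have "{x. x v* X = 0} = {x \<in> UNIV. \<forall>y \<in> range ((*v) X). orthogonal y x}"
  proof -
    have "x v* X = 0 \<longleftrightarrow> (\<forall>z. orthogonal (X *v z) x)" for x
      using inner_eq_zero_iff[of "x v* X"]
      by (auto simp: orthogonal_def inner_commute[of _ x] simp flip: dot_lmul_matrix)
    then show ?thesis by auto
  qed
  ultimately show ?thesis
    using dim_subspace_orthogonal_to_vectors[of "range ((*v) X)" UNIV]
    by (simp add: rank_dim_range)
qed

text \<open>On its left kernel \<open>X\<close> agrees with the zero matrix, so the subspace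
  comparison with \<open>d = rank X\<close> bounds this singular value by one of the zero
  matrix.\<close>

lemma singular_value_eq_0:
  fixes X :: "real ^ 'n ^ 'm"
  assumes "rank X \<le> i" "i < CARD('m)"
  shows "singular_value (Suc i) X = 0"
proof -
  have "singular_value (Suc ((i - rank X) + rank X)) X \<le> singular_value (Suc (i - rank X)) (0 :: real^'n^'m)"
    using dim_left_kernel[of X] assms
    by (intro singular_value_le_on_subspace[OF subspace_left_kernel[of X]]) auto
  moreover have "singular_value (Suc j) (0 :: real^'n^'m) = 0" if "j < CARD('m)" for j
  proof -
    obtain u where "\<And>i j. i < CARD('m) \<Longrightarrow> j < CARD('m) \<Longrightarrow>
       (u i v* (0 :: real^'n^'m)) \<bullet> (u j v* (0 :: real^'n^'m)) =
         (if i = j then (singular_value (Suc i) (0 :: real^'n^'m))\<^sup>2 else 0)"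
      using left_singular_basis by blast
    from this[OF that that] show ?thesis by simp
  qed
  ultimately have "singular_value (Suc i) X \<le> 0"
    using assms by simp
  then show ?thesis
    using singular_value_nonneg[OF assms(2), of X] by linarith
qed

section \<open>Subadditivity of the penalty\<close>

text \<open>Writing \<open>H\<close> for the operator with quadratic form \<open>\<Sum>k. c k * (w k \<bullet> y)\<^sup>2\<close> and \<open>G\<close> for the
  inverse of \<open>1 + H\<close>, both sides are compared with \<open>tr (H G) = DIM('a) - tr G\<close>. The only analytic
  input is that \<open>e \<bullet> G e \<le> 1 / (t + 1)\<close> whenever \<open>H\<close> dominates \<open>t\<close> times the projection to \<open>e\<close>.\<close>

lemma sum_frac_le_of_rank_one_majorant:
  fixes u :: "nat \<Rightarrow> 'a::euclidean_space" and w :: "'i \<Rightarrow> 'a"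
  assumes u: "orthonormal_seq u" and "finite I"
    and x0: "\<And>i. i < DIM('a) \<Longrightarrow> 0 \<le> x i"
    and c0: "\<And>k. k \<in> I \<Longrightarrow> 0 \<le> c k" and w1: "\<And>k. k \<in> I \<Longrightarrow> norm (w k) \<le> 1"
    and le: "\<And>y. (\<Sum>i<DIM('a). x i * (u i \<bullet> y)\<^sup>2) \<le> (\<Sum>k\<in>I. c k * (w k \<bullet> y)\<^sup>2)"
  shows "(\<Sum>i<DIM('a). x i / (x i + 1)) \<le> (\<Sum>k\<in>I. c k / (c k + 1))"
proof -
  define H where "H y = (\<Sum>k\<in>I. (c k * (w k \<bullet> y)) *\<^sub>R w k)" for y
  define F where "F y = y + H y" for y
  have HH: "y \<bullet> H y = (\<Sum>k\<in>I. c k * (w k \<bullet> y)\<^sup>2)" for y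
    by (simp add: H_def inner_sum_right power2_eq_square inner_commute mult.assoc)
  have Hlin: "linear H"
    by (rule linearI)
       (simp_all add: H_def inner_add_right distrib_left scaleR_add_left sum.distrib
          scaleR_sum_right mult.left_commute)
  have Flin: "linear F"
    unfolding F_def using Hlin by (intro linear_compose_add linear_id[unfolded id_def])
  have Hpos: "0 \<le> y \<bullet> H y" for y
    unfolding HH using c0 by (intro sum_nonneg) auto
  have "inj F"
  proof (rule linear_injective_0[OF Flin, THEN iffD2], intro allI impI)
    fix y assume "F y = 0"
    then have "y \<bullet> y + y \<bullet> H y = 0"
      by (metis F_def inner_add_right inner_zero_right)
    then show "y = 0"
      using Hpos[of y] inner_ge_zero[of y] by (metis add_nonneg_eq_0_iff inner_eq_zero_iff)
  qed
  then obtain G where G: "linear G" "\<And>y. F (G y) = y"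
    using linear_injective_isomorphism[OF Flin] by blast
  \<comment> \<open>With \<open>z = G e\<close> and \<open>q = e \<bullet> z\<close>, the equation
    \<open>e = z + H z\<close> gives \<open>q = z \<bullet> z + z \<bullet> H z\<close>.
    Cauchy-Schwarz and the domination hypothesis bound this below by
    \<open>(1 + t) * q\<^sup>2\<close>.\<close>
  have resolvent: "e \<bullet> G e \<le> 1 / (t + 1)"
    if "norm e \<le> 1" "0 \<le> t" "\<And>z. t * (e \<bullet> z)\<^sup>2 \<le> z \<bullet> H z" for e t
  proof -
    define z where "z = G e"
    define q where "q = e \<bullet> z"
    have "\<bar>q\<bar> \<le> norm e * norm z"
      unfolding q_def by (rule Cauchy_Schwarz_ineq2)
    also have "\<dots> \<le> norm z"
      using that(1) mult_right_mono by fastforce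
    finally have "q\<^sup>2 \<le> z \<bullet> z"
      by (metis abs_le_square_iff abs_norm_cancel power2_norm_eq_inner)
    moreover have "q = z \<bullet> z + z \<bullet> H z"
    proof -
      have "e = z + H z" using G(2)[of e] by (simp add: F_def z_def)
      then show ?thesis
        unfolding q_def by (metis inner_add_right inner_commute)
    qed
    ultimately have "q * (q * (t + 1)) \<le> q * 1"
      using that(3)[of z] by (simp add: q_def power2_eq_square algebra_simps)
    then have "q * (t + 1) \<le> 1"
    proof (cases "q > 0")
      case True
      then show ?thesis
        using \<open>q * (q * (t + 1)) \<le> q * 1\<close> mult_le_cancel_left_pos by blast
    next
      case False
      then have "q * (t + 1) \<le> 0"
        using that(2) by (intro mult_nonpos_nonneg) auto
      then show ?thesis by linarith
    qed
    then show ?thesis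
      using that(2) by (simp add: q_def z_def field_simps)
  qed
  \<comment> \<open>The trace of \<open>H G\<close>, computed in the basis \<open>u\<close> and
    rewritten through the rank-one terms of \<open>H\<close> by expanding each
    \<open>w k\<close>.\<close>
  have tr: "(\<Sum>i<DIM('a). u i \<bullet> H (G (u i))) = (\<Sum>k\<in>I. c k * (w k \<bullet> G (w k)))"
  proof -
    have "(\<Sum>i<DIM('a). u i \<bullet> H (G (u i)))
      = (\<Sum>i<DIM('a). \<Sum>k\<in>I. c k * ((u i \<bullet> w k) * (w k \<bullet> G (u i))))"
      by (simp add: H_def inner_sum_right mult_ac)
    also have "\<dots> = (\<Sum>k\<in>I. \<Sum>i<DIM('a). c k * ((u i \<bullet> w k) * (w k \<bullet> G (u i))))"
      by (rule sum.swap)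
    also have "\<dots> = (\<Sum>k\<in>I. c k * (w k \<bullet> G (\<Sum>i<DIM('a). (u i \<bullet> w k) *\<^sub>R u i)))"
      by (simp add: linear_sum[OF G(1)] linear_cmul[OF G(1)] inner_sum_right sum_distrib_left)
    finally show ?thesis by (simp only: orthonormal_seq_expand[OF u])
  qed
  have "real DIM('a) = (\<Sum>i<DIM('a). u i \<bullet> F (G (u i)))"
    using orthonormal_seqD[OF u] by (simp add: G(2))
  also have "\<dots> = (\<Sum>i<DIM('a). u i \<bullet> G (u i)) + (\<Sum>k\<in>I. c k * (w k \<bullet> G (w k)))"
    by (simp add: F_def inner_add_right sum.distrib tr)
  finally have split: "real DIM('a) = \<dots>" .
  have "(\<Sum>i<DIM('a). u i \<bullet> G (u i)) \<le> (\<Sum>i<DIM('a). 1 / (x i + 1))"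
  proof (rule sum_mono)
    fix i assume "i \<in> {..<DIM('a)}"
    then have i: "i < DIM('a)" by simp
    have "x i * (u i \<bullet> z)\<^sup>2 \<le> z \<bullet> H z" for z
    proof -
      have "x i * (u i \<bullet> z)\<^sup>2 \<le> (\<Sum>i<DIM('a). x i * (u i \<bullet> z)\<^sup>2)"
        using i x0 by (intro member_le_sum) auto
      then show ?thesis using le[of z] by (simp add: HH)
    qed
    moreover have "norm (u i) \<le> 1"
      using orthonormal_seqD[OF u i i] by (simp add: norm_eq_1[THEN iffD2])
    ultimately show "u i \<bullet> G (u i) \<le> 1 / (x i + 1)"
      using x0[OF i] by (intro resolvent)
  qed
  moreover have "(\<Sum>k\<in>I. c k * (w k \<bullet> G (w k))) \<le> (\<Sum>k\<in>I. c k * (1 / (c k + 1)))"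
  proof (intro sum_mono mult_left_mono resolvent)
    fix k z assume "k \<in> I"
    then show "c k * (w k \<bullet> z)\<^sup>2 \<le> z \<bullet> H z"
      unfolding HH using \<open>finite I\<close> c0
      by (intro member_le_sum[of k I "\<lambda>k. c k * (w k \<bullet> z)\<^sup>2"]) auto
  qed (use c0 w1 in auto)
  \<comment> \<open>Rewriting each term as \<open>1 - 1 / (x i + 1)\<close> makes the upper bound on
    the trace of \<open>G\<close> an upper bound on the left-hand sum.\<close>
  moreover have "(\<Sum>i<DIM('a). x i / (x i + 1)) = (\<Sum>i<DIM('a). 1 - 1 / (x i + 1))"
    by (intro sum.cong refl) (use x0 in \<open>force simp: field_simps\<close>)
  then have "(\<Sum>i<DIM('a). x i / (x i + 1)) = real DIM('a) - (\<Sum>i<DIM('a). 1 / (x i + 1))"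
    by (simp add: sum_subtractf)
  ultimately show ?thesis
    using split by simp
qed

text \<open>The rank-one terms come from \<open>s * t \<le> ((s + t) / 2)\<^sup>2\<close>.\<close>

lemma rank_one_majorant:
  fixes A :: "real ^ 'n ^ 'm" and V :: "real ^ 'n \<Rightarrow> real ^ 'm"
  assumes adj: "\<And>q y. q \<bullet> W y = V q \<bullet> y" and contr: "\<And>q. norm (V q) \<le> norm q"
  obtains w :: "nat \<Rightarrow> real ^ 'm" where "\<And>k. k < CARD('m) \<Longrightarrow> norm (w k) \<le> 1"
    "\<And>y. (y v* A) \<bullet> W y \<le> (\<Sum>k<CARD('m). singular_value (Suc k) A * (w k \<bullet> y)\<^sup>2)"
proof -
  obtain p :: "nat \<Rightarrow> real ^ 'm" and q :: "nat \<Rightarrow> real ^ 'n" where p: "orthonormal_seq p"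
    and q: "\<And>i j. i < CARD('m) \<Longrightarrow> j < CARD('m) \<Longrightarrow>
       q i \<bullet> q j = (if i = j \<and> singular_value (Suc i) A \<noteq> 0 then 1 else 0)"
    and A: "\<And>x. x v* A = (\<Sum>i<CARD('m). (singular_value (Suc i) A * (p i \<bullet> x)) *\<^sub>R q i)"
    using singular_value_decomposition[of A] by blast
  \<comment> \<open>The half-sum of two vectors of norm at most 1 has norm at most 1, and its
    squared inner product with \<open>y\<close> dominates the product of the two separate
    ones.\<close>
  define w where "w k = (1 / 2) *\<^sub>R (p k + V (q k))" for k
  have "norm (w k) \<le> 1" if "k < CARD('m)" for k
  proof -
    have "norm (p k) = 1"
      using orthonormal_seqD[OF p, of k k] that by (simp add: norm_eq_1)
    moreover have "norm (q k) \<le> 1"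
      using q[OF that that] by (simp add: norm_le_square split: if_splits)
    ultimately have "norm (p k + V (q k)) \<le> 2"
      using contr[of "q k"] norm_triangle_ineq[of "p k" "V (q k)"] by linarith
    then show ?thesis by (simp add: w_def)
  qed
  moreover have "(y v* A) \<bullet> W y \<le> (\<Sum>k<CARD('m). singular_value (Suc k) A * (w k \<bullet> y)\<^sup>2)" for y
  proof -
    have "(y v* A) \<bullet> W y
      = (\<Sum>k<CARD('m). singular_value (Suc k) A * ((p k \<bullet> y) * (V (q k) \<bullet> y)))"
      by (simp add: A inner_sum_left mult.assoc flip: adj)
    also have "\<dots> \<le> (\<Sum>k<CARD('m). singular_value (Suc k) A * (w k \<bullet> y)\<^sup>2)"
    proof (intro sum_mono mult_left_mono)
      fix k
      define s t where "s = p k \<bullet> y" and "t = V (q k) \<bullet> y"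
      have "0 \<le> (s - t)\<^sup>2" by simp
      then have "s * t \<le> ((s + t) / 2)\<^sup>2"
        by (simp add: power2_eq_square field_simps)
      then show "(p k \<bullet> y) * (V (q k) \<bullet> y) \<le> (w k \<bullet> y)\<^sup>2"
        by (simp add: w_def s_def t_def inner_add_left)
    qed (use singular_value_nonneg in auto)
    finally show ?thesis .
  qed
  ultimately show thesis using that by blast
qed

text \<open>Rotfel'd's inequality, specialised to this penalty.\<close>

lemma frac_penalty_triangle:
  fixes A B :: "real ^ 'n ^ 'm"
  assumes "0 \<le> a"
  shows "frac_penalty a (A + B) \<le> frac_penalty a A + frac_penalty a B"
proof -
  define m where "m = CARD('m)"
  define s where "s i = singular_value (Suc i) (A + B)" for i
  obtain u :: "nat \<Rightarrow> real ^ 'm" and v :: "nat \<Rightarrow> real ^ 'n" where u: "orthonormal_seq u"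
    and v: "\<And>i j. i < m \<Longrightarrow> j < m \<Longrightarrow> v i \<bullet> v j = (if i = j \<and> s i \<noteq> 0 then 1 else 0)"
    and AB: "\<And>x. x v* (A + B) = (\<Sum>i<m. (s i * (u i \<bullet> x)) *\<^sub>R v i)"
    using singular_value_decomposition[of "A + B"] unfolding s_def m_def by blast
  \<comment> \<open>\<open>W\<close> is the partial isometry from the polar decomposition of
    \<open>A + B\<close>: pairing \<open>y v* (A + B)\<close> with \<open>W y\<close> diagonalises
    the form to the weights \<open>s i\<close>. Pairing with the same \<open>W\<close> keeps the
    expression additive in \<open>A\<close> and \<open>B\<close>. \<open>V\<close> is the adjoint of
    \<open>W\<close>.\<close>
  define W where "W y = (\<Sum>i<m. (u i \<bullet> y) *\<^sub>R v i)" for y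
  define V where "V q = (\<Sum>i<m. (v i \<bullet> q) *\<^sub>R u i)" for q
  have adj: "q \<bullet> W y = V q \<bullet> y" for q y
    by (simp add: W_def V_def inner_sum_left inner_sum_right inner_commute mult.commute)
  have W1: "norm (W y) \<le> norm y" for y
  proof -
    have "(norm (W y))\<^sup>2 = (\<Sum>i<m. (u i \<bullet> y)\<^sup>2 * (v i \<bullet> v i))"
      unfolding W_def using v by (intro norm_orthogonal_sum_sq) auto
    also have "\<dots> \<le> (\<Sum>i<m. (u i \<bullet> y)\<^sup>2)"
      using v by (intro sum_mono) auto
    also have "\<dots> = (norm y)\<^sup>2"
      using orthonormal_seq_inner[OF u, of y y]
      by (simp add: m_def power2_norm_eq_inner flip: power2_eq_square)
    finally show ?thesis
      by (rule power2_le_imp_le) simp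
  qed
  have V1: "norm (V q) \<le> norm q" for q
  proof (cases "V q = 0")
    case False
    have "(norm (V q))\<^sup>2 = q \<bullet> W (V q)"
      by (simp add: adj power2_norm_eq_inner)
    also have "\<dots> \<le> norm q * norm (W (V q))"
      by (rule norm_cauchy_schwarz)
    also have "\<dots> \<le> norm q * norm (V q)"
      by (intro mult_left_mono W1) auto
    finally show ?thesis
      using False by (simp add: power2_eq_square)
  qed simp
  obtain wA where wA: "\<And>k. k < m \<Longrightarrow> norm (wA k) \<le> 1"
    "\<And>y. (y v* A) \<bullet> W y \<le> (\<Sum>k<m. singular_value (Suc k) A * (wA k \<bullet> y)\<^sup>2)"
    using rank_one_majorant[OF adj V1, of A] unfolding m_def by blast
  obtain wB where wB: "\<And>k. k < m \<Longrightarrow> norm (wB k) \<le> 1"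
    "\<And>y. (y v* B) \<bullet> W y \<le> (\<Sum>k<m. singular_value (Suc k) B * (wB k \<bullet> y)\<^sup>2)"
    using rank_one_majorant[OF adj V1, of B] unfolding m_def by blast
  \<comment> \<open>The disjoint union treats the rank-one terms of \<open>A\<close> and of
    \<open>B\<close> as a single family.\<close>
  define I where "I = {..<m} <+> {..<m}"
  define c where "c = case_sum (\<lambda>k. a * singular_value (Suc k) A) (\<lambda>k. a * singular_value (Suc k) B)"
  define w where "w = case_sum wA wB"
  have "(\<Sum>i<DIM(real^'m). a * s i / (a * s i + 1)) \<le> (\<Sum>k\<in>I. c k / (c k + 1))"
  proof (rule sum_frac_le_of_rank_one_majorant[OF u])
    show "finite I" by (simp add: I_def)
    show "0 \<le> a * s i" if "i < DIM(real^'m)" for i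
      using that assms by (simp add: s_def singular_value_nonneg)
    show "0 \<le> c k" if "k \<in> I" for k
      using that assms by (auto simp: I_def c_def m_def singular_value_nonneg)
    show "norm (w k) \<le> 1" if "k \<in> I" for k
      using that wA(1) wB(1) by (auto simp: I_def w_def)
    fix y
    have "(\<Sum>i<m. s i * (u i \<bullet> y)\<^sup>2) = (y v* (A + B)) \<bullet> W y"
    proof -
      \<comment> \<open>Where \<open>s i = 0\<close> the vector \<open>v i\<close> vanishes, but the
        factor \<open>s i\<close> removes that term anyway.\<close>
      have "v i \<bullet> W y = (if s i \<noteq> 0 then u i \<bullet> y else 0)" if "i < m" for i
      proof -
        have "v i \<bullet> W y = (\<Sum>j<m. if j = i then (if s i \<noteq> 0 then u i \<bullet> y else 0) else 0)"
          unfolding W_def inner_sum_right using v[OF that] by (intro sum.cong refl) auto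
        then show ?thesis using that by simp
      qed
      then show ?thesis
        unfolding AB inner_sum_left by (intro sum.cong refl) (auto simp: power2_eq_square)
    qed
    also have "\<dots> = (y v* A) \<bullet> W y + (y v* B) \<bullet> W y"
      by (simp add: vector_matrix_mult_add_rdistrib inner_add_left)
    also have "\<dots> \<le> (\<Sum>k<m. singular_value (Suc k) A * (wA k \<bullet> y)\<^sup>2)
        + (\<Sum>k<m. singular_value (Suc k) B * (wB k \<bullet> y)\<^sup>2)"
      by (rule add_mono[OF wA(2) wB(2)])
    finally have "a * (\<Sum>i<m. s i * (u i \<bullet> y)\<^sup>2)
      \<le> a * ((\<Sum>k<m. singular_value (Suc k) A * (wA k \<bullet> y)\<^sup>2)
        + (\<Sum>k<m. singular_value (Suc k) B * (wB k \<bullet> y)\<^sup>2))"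
      using assms by (rule mult_left_mono)
    moreover have "(\<Sum>i<DIM(real^'m). a * s i * (u i \<bullet> y)\<^sup>2) = a * (\<Sum>i<m. s i * (u i \<bullet> y)\<^sup>2)"
      by (simp add: m_def sum_distrib_left mult.assoc)
    moreover have "(\<Sum>k\<in>I. c k * (w k \<bullet> y)\<^sup>2)
      = a * ((\<Sum>k<m. singular_value (Suc k) A * (wA k \<bullet> y)\<^sup>2)
        + (\<Sum>k<m. singular_value (Suc k) B * (wB k \<bullet> y)\<^sup>2))"
      unfolding I_def distrib_left sum_distrib_left
      by (subst sum.Plus) (simp_all add: c_def w_def mult.assoc)
    ultimately show "(\<Sum>i<DIM(real^'m). a * s i * (u i \<bullet> y)\<^sup>2) \<le> (\<Sum>k\<in>I. c k * (w k \<bullet> y)\<^sup>2)"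
      by (simp only:)
  qed
  moreover have "(\<Sum>k\<in>I. c k / (c k + 1)) = frac_penalty a A + frac_penalty a B"
    unfolding I_def m_def frac_penalty_eq by (subst sum.Plus) (simp_all add: c_def)
  moreover have "(\<Sum>i<DIM(real^'m). a * s i / (a * s i + 1)) = frac_penalty a (A + B)"
    by (simp add: frac_penalty_eq s_def)
  ultimately show ?thesis by (simp only:)
qed

section \<open>Sums of rank-one matrices\<close>

definition outer_prod :: "real ^ 'm \<Rightarrow> real ^ 'n \<Rightarrow> real ^ 'n ^ 'm" where
  "outer_prod u v = (\<chi> i. (u $ i) *\<^sub>R v)"

lemma vector_matrix_mult_outer_prod: "x v* outer_prod u v = (u \<bullet> x) *\<^sub>R v"
  by (simp add: vec_eq_iff outer_prod_def vector_matrix_mult_def inner_vec_def sum_distrib_left mult_ac)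

lemma inner_outer_prod: "outer_prod u v \<bullet> outer_prod u' v' = (u \<bullet> u') * (v \<bullet> v')"
  unfolding outer_prod_def inner_vec_def[of "vec_lambda _"]
  by (simp add: inner_vec_def[of u] sum_distrib_left mult_ac)

lemma vector_matrix_mult_sum_right: "x v* (\<Sum>i\<in>I. M i) = (\<Sum>i\<in>I. x v* M i)"
  for M :: "'i \<Rightarrow> real ^ 'n ^ 'm"
  by (induction I rule: infinite_finite_induct) (simp_all add: vector_matrix_mult_add_rdistrib)

lemma matrix_eq_vector_matrix_mult:
  fixes A B :: "real ^ 'n ^ 'm"
  shows "A = B \<longleftrightarrow> (\<forall>x. x v* A = x v* B)"
  by (metis matrix_eq transpose_matrix_vector transpose_transpose)

text \<open>Every row of the sum is a combination of the vectors \<open>v i\<close>.\<close>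

lemma rank_sum_outer_prod_le:
  assumes "finite I"
  shows "rank (\<Sum>i\<in>I. outer_prod (u i) (v i)) \<le> card I"
proof -
  have "row k (\<Sum>i\<in>I. outer_prod (u i) (v i)) = (\<Sum>i\<in>I. (u i $ k) *\<^sub>R v i)" for k
    by (simp add: vec_eq_iff row_def outer_prod_def)
  then have "rows (\<Sum>i\<in>I. outer_prod (u i) (v i)) \<subseteq> span (v ` I)"
    by (force simp: rows_def intro: span_sum span_mul span_base)
  then have "rank (\<Sum>i\<in>I. outer_prod (u i) (v i)) \<le> card (v ` I)"
    unfolding row_rank_def using assms by (intro dim_le_card) auto
  also have "\<dots> \<le> card I"
    using assms by (rule card_image_le)
  finally show ?thesis .
qed

text \<open>\<open>Q\<close> is the orthogonal projection onto the row space, the sum of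
  \<open>outer_prod b b\<close> over an orthonormal basis. It fixes the rows of \<open>X\<close>,
  and it is a contraction because \<open>y v* Q\<close> has squared norm
  \<open>(y v* Q) \<bullet> y\<close>.\<close>

lemma row_space_projection:
  fixes X :: "real ^ 'n ^ 'm"
  obtains Q :: "real ^ 'n ^ 'n" where "X ** Q = X" "rank Q \<le> rank X"
    "\<And>y. norm (y v* Q) \<le> norm y"
proof -
  obtain B where B: "B \<subseteq> span (rows X)" "pairwise orthogonal B"
    "\<And>b. b \<in> B \<Longrightarrow> norm b = 1" "independent B" "card B = dim (span (rows X))"
    "span B = span (rows X)"
    using orthonormal_basis_subspace[of "span (rows X)"] by auto
  have "finite B" using B(4) independent_imp_finite by blast
  define Q where "Q = (\<Sum>b\<in>B. outer_prod b b)"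
  have Q: "y v* Q = (\<Sum>b\<in>B. (y \<bullet> b) *\<^sub>R b)" for y
    by (simp add: Q_def vector_matrix_mult_sum_right vector_matrix_mult_outer_prod inner_commute)
  have "x v* (X ** Q) = x v* X" for x
  proof -
    have "x v* X = (\<Sum>i\<in>UNIV. (x $ i) *\<^sub>R row i X)"
      by (simp add: vec_eq_iff vector_matrix_mult_def row_def mult.commute)
    also have "\<dots> \<in> span (rows X)"
      by (intro span_sum span_mul span_base) (auto simp: rows_def)
    finally have "(x v* X) v* Q = x v* X"
      unfolding Q using orthonormal_basis_expand[OF B(2,3)] B(6) \<open>finite B\<close> by simp
    then show ?thesis by (simp add: vector_matrix_mul_assoc)
  qed
  then have "X ** Q = X"
    by (simp add: matrix_eq_vector_matrix_mult)
  moreover have "rank Q \<le> rank X"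
    using rank_sum_outer_prod_le[OF \<open>finite B\<close>, of "\<lambda>b. b" "\<lambda>b. b"] B(5)
    by (simp add: Q_def row_rank_def)
  moreover have "norm (y v* Q) \<le> norm y" for y
  proof (cases "y v* Q = 0")
    case False
    have "(norm (y v* Q))\<^sup>2 = (\<Sum>b\<in>B. (y \<bullet> b)\<^sup>2 * (b \<bullet> b))"
      unfolding Q using \<open>finite B\<close> B(2)
      by (intro norm_orthogonal_sum_sq) (auto simp: pairwise_def orthogonal_def)
    also have "\<dots> = (y v* Q) \<bullet> y"
      unfolding Q inner_sum_left using B(3)
      by (intro sum.cong refl) (simp add: norm_eq_1 power2_eq_square inner_commute)
    also have "\<dots> \<le> norm (y v* Q) * norm y"
      by (rule norm_cauchy_schwarz)
    finally show ?thesis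
      using False by (simp add: power2_eq_square)
  qed simp
  ultimately show thesis using that by blast
qed

section \<open>The null space property\<close>

lemma frac_mono:
  fixes a s t :: real
  assumes "0 \<le> a" "0 \<le> s" "s \<le> t"
  shows "a * s / (a * s + 1) \<le> a * t / (a * t + 1)"
proof -
  have "0 \<le> a * s" "a * s \<le> a * t"
    using assms by (auto intro: mult_left_mono)
  then show ?thesis
    by (simp add: divide_simps) (simp add: algebra_simps)
qed

text \<open>Singular values of \<open>N\<close> from index \<open>T\<close> on vanish, and the
  others are dominated by those of \<open>M\<close>. It is applied to matrices compressed by the
  projection \<open>Q\<close>.\<close>

lemma frac_penalty_le_of_rank:
  fixes N M :: "real ^ 'n ^ 'm"
  assumes "0 \<le> a" "rank N \<le> T" "T \<le> CARD('m)" and le: "\<And>x. norm (x v* N) \<le> norm (x v* M)"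
  shows "frac_penalty a N
    \<le> (\<Sum>i<T. a * singular_value (Suc i) M / (a * singular_value (Suc i) M + 1))"
proof -
  have "frac_penalty a N
    = (\<Sum>i<T. a * singular_value (Suc i) N / (a * singular_value (Suc i) N + 1))"
    unfolding frac_penalty_eq using assms(2,3) singular_value_eq_0[of N]
    by (intro sum.mono_neutral_right) auto
  also have "\<dots> \<le> (\<Sum>i<T. a * singular_value (Suc i) M / (a * singular_value (Suc i) M + 1))"
    using assms(1,3) singular_value_mono[OF le] singular_value_nonneg[of _ N]
    by (intro sum_mono frac_mono) auto
  finally show ?thesis .
qed

lemma frac_null_space_property:
  fixes X Z :: "real ^ 'n ^ 'm"
  assumes a: "0 \<le> a" and T: "2 * rank X \<le> CARD('m)"
    and le: "frac_penalty a (X + Z) \<le> frac_penalty a X"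
  shows "(\<Sum>i\<in>{2 * rank X..<CARD('m)}. a * singular_value (Suc i) Z / (a * singular_value (Suc i) Z + 1))
    \<le> (\<Sum>i<rank X. a * singular_value (Suc i) Z / (a * singular_value (Suc i) Z + 1))"
proof -
  define m where "m = CARD('m)"
  define T where "T = rank X"
  define f where "f M i = a * singular_value (Suc i) M / (a * singular_value (Suc i) M + 1)"
    for M :: "real^'n^'m" and i
  have Tm: "2 * T \<le> m"
    using assms(2) by (simp add: T_def m_def)
  obtain Q :: "real ^ 'n ^ 'n" where Q: "X ** Q = X" "rank Q \<le> rank X"
    "\<And>y. norm (y v* Q) \<le> norm y"
    using row_space_projection[of X] by blast
  have r: "rank (M ** Q) \<le> T" for M :: "real^'n^'m"
    using rank_mul_le_right[of M Q] Q(2) by (simp add: T_def)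
  have nQ: "norm (x v* (M ** Q)) \<le> norm (x v* M)" for x and M :: "real^'n^'m"
    using Q(3)[of "x v* M"] by (simp add: vector_matrix_mul_assoc)
  have "X = (X + Z) ** Q + (- Z) ** Q"
  proof -
    have "x v* ((X + Z) ** Q + (- Z) ** Q) = x v* (X ** Q)" for x
    proof -
      have "x v* ((X + Z) ** Q + (- Z) ** Q) = (x v* (X + Z)) v* Q + (x v* (- Z)) v* Q"
        by (simp only: vector_matrix_mult_add_rdistrib[of x "(X + Z) ** Q"] vector_matrix_mul_assoc)
      also have "\<dots> = (x v* (X + Z - Z)) v* Q"
        by (simp only: diff_conv_add_uminus vector_matrix_mult_add_rdistrib[of x "X + Z"]
            vector_matrix_left_distrib)
      finally show ?thesis by (simp add: vector_matrix_mul_assoc)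
    qed
    then show ?thesis
      using Q(1) by (simp add: matrix_eq_vector_matrix_mult)
  qed
  then have "frac_penalty a X \<le> frac_penalty a ((X + Z) ** Q) + frac_penalty a ((- Z) ** Q)"
    using frac_penalty_triangle[OF a] by metis
  also have "\<dots> \<le> (\<Sum>i<T. f (X + Z) i) + (\<Sum>i<T. f Z i)"
  proof (rule add_mono)
    show "frac_penalty a ((X + Z) ** Q) \<le> (\<Sum>i<T. f (X + Z) i)"
      unfolding f_def using Tm by (intro frac_penalty_le_of_rank a r nQ) (simp add: m_def)
    have "norm (x v* ((- Z) ** Q)) \<le> norm (x v* Z)" for x
    proof -
      have "x v* (- Z) = - (x v* Z)"
        by (simp add: vec_eq_iff vector_matrix_mult_def sum_negf)
      then show ?thesis
        using nQ[of x "- Z"] by simp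
    qed
    then show "frac_penalty a ((- Z) ** Q) \<le> (\<Sum>i<T. f Z i)"
      unfolding f_def using Tm by (intro frac_penalty_le_of_rank a r) (simp_all add: m_def)
  qed
  finally have upper: "frac_penalty a X \<le> (\<Sum>i<T. f (X + Z) i) + (\<Sum>i<T. f Z i)" .
  have f0: "0 \<le> f M i" if "i < m" for M i
    using that a singular_value_nonneg[of i M] by (simp add: f_def m_def)
  \<comment> \<open>Shifting by \<open>T\<close> lines up index \<open>i + T\<close> of
    \<open>Z\<close> with index \<open>i\<close> of \<open>X + Z\<close>, as Weyl's inequality
    requires.\<close>
  have "(\<Sum>i\<in>{2 * T..<m}. f Z i) = (\<Sum>i\<in>{T..<m - T}. f Z (i + T))"
    using sum.shift_bounds_nat_ivl[of "f Z" T T "m - T"] Tm by (simp add: mult_2)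
  also have "\<dots> \<le> (\<Sum>i\<in>{T..<m - T}. f (X + Z) i)"
  proof (rule sum_mono)
    fix i assume i: "i \<in> {T..<m - T}"
    have "singular_value (Suc (i + T)) Z \<le> singular_value (Suc i) (X + Z)"
      using i dim_left_kernel[of X]
      \<comment> \<open>On the left kernel of \<open>X\<close>, of codimension \<open>T\<close>, the
        matrices \<open>Z\<close> and \<open>X + Z\<close> act identically.\<close>
      by (intro singular_value_le_on_subspace[OF subspace_left_kernel[of X]])
         (auto simp: T_def m_def vector_matrix_mult_add_rdistrib)
    then show "f Z (i + T) \<le> f (X + Z) i"
      unfolding f_def using i a
      by (intro frac_mono) (auto simp: m_def intro!: singular_value_nonneg)
  qed
  also have "\<dots> \<le> (\<Sum>i\<in>{T..<m}. f (X + Z) i)"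
    using f0 by (intro sum_mono2) auto
  \<comment> \<open>The added first \<open>T\<close> terms of \<open>X + Z\<close> also occur in
    \<open>upper\<close>, so they cancel once minimality is used.\<close>
  finally have "(\<Sum>i<T. f (X + Z) i) + (\<Sum>i\<in>{2 * T..<m}. f Z i)
    \<le> (\<Sum>i<T. f (X + Z) i) + (\<Sum>i\<in>{T..<m}. f (X + Z) i)"
    by simp
  also have "\<dots> = frac_penalty a (X + Z)"
    using Tm by (simp add: frac_penalty_eq f_def m_def lessThan_atLeast0 sum.atLeastLessThan_concat)
  finally have "(\<Sum>i\<in>{2 * T..<m}. f Z i) \<le> (\<Sum>i<T. f Z i)"
    using le upper by linarith
  then show ?thesis by (simp add: f_def T_def m_def)
qed

text \<open>Since \<open>t \<mapsto> a t / (a t + 1)\<close> has decreasing slope from the origin, comparing with the chord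
  at \<open>s n\<close> removes the penalty from the inequality.\<close>

lemma sum_tail_le_of_frac:
  fixes s :: "nat \<Rightarrow> real"
  assumes a: "0 < a" and s0: "\<And>i. i < m \<Longrightarrow> 0 \<le> s i"
    and dec: "\<And>i j. i \<le> j \<Longrightarrow> j < m \<Longrightarrow> s j \<le> s i" and "n \<le> m"
    and le: "(\<Sum>i\<in>{n..<m}. a * s i / (a * s i + 1)) \<le> (\<Sum>i<n. a * s i / (a * s i + 1))"
  shows "(\<Sum>i\<in>{n..<m}. s i) \<le> (\<Sum>i<n. s i)"
proof (cases "n < m")
  case True
  have sn: "0 \<le> a * s n" using s0[OF True] a by simp
  \<comment> \<open>The slope of the chord from the origin at \<open>s n\<close>: the line
    \<open>h * s i\<close> lies below the penalty for \<open>i \<ge> n\<close> and above it for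
    \<open>i < n\<close>.\<close>
  define h where "h = a / (a * s n + 1)"
  have h: "0 < h" using sn a by (simp add: h_def)
  have "h * (\<Sum>i\<in>{n..<m}. s i) \<le> (\<Sum>i\<in>{n..<m}. a * s i / (a * s i + 1))"
    unfolding sum_distrib_left
  proof (rule sum_mono)
    fix i assume i: "i \<in> {n..<m}"
    have "a * s i / (a * s n + 1) \<le> a * s i / (a * s i + 1)"
      using i a s0[of i] dec[of n i] by (intro divide_left_mono) (auto intro!: mult_pos_pos add_nonneg_pos sn)
    then show "h * s i \<le> a * s i / (a * s i + 1)" by (simp add: h_def)
  qed
  also note le
  also have "(\<Sum>i<n. a * s i / (a * s i + 1)) \<le> h * (\<Sum>i<n. s i)"
    unfolding sum_distrib_left
  proof (rule sum_mono)
    fix i assume i: "i \<in> {..<n}"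
    have "a * s i / (a * s i + 1) \<le> a * s i / (a * s n + 1)"
      using i True a s0[of i] dec[of i n] by (intro divide_left_mono) (auto intro!: mult_pos_pos add_nonneg_pos sn)
    then show "a * s i / (a * s i + 1) \<le> h * s i" by (simp add: h_def)
  qed
  finally show ?thesis using h by simp
next
  case False
  then show ?thesis using s0 \<open>n \<le> m\<close> by (auto intro!: sum_nonneg)
qed

section \<open>Restricted isometry and exact recovery\<close>

text \<open>The \<open>LEAST\<close> in the definition has its defining property only if a minimum
  exists. The admissible constants form a closed set, nonempty because \<open>\<A>\<close> is
  bounded, and bounded below by 0, as a rank-one matrix of norm 1 shows.\<close>

lemma restricted_isometry_const_bounds:
  fixes \<A> :: "real ^ 'n ^ 'm \<Rightarrow> real ^ 'd"
  assumes lin: "linear \<A>" and "1 \<le> r"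
  defines "\<delta> \<equiv> restricted_isometry_const \<A> r"
  shows "rank X \<le> r \<Longrightarrow> (1 - \<delta>) * (norm X)\<^sup>2 \<le> (norm (\<A> X))\<^sup>2"
    and "rank X \<le> r \<Longrightarrow> (norm (\<A> X))\<^sup>2 \<le> (1 + \<delta>) * (norm X)\<^sup>2"
    and "0 \<le> \<delta>"
proof -
  define P where "P \<delta> \<longleftrightarrow> (\<forall>X. rank X \<le> r \<longrightarrow>
    (1 - \<delta>) * (norm X)\<^sup>2 \<le> (norm (\<A> X))\<^sup>2 \<and> (norm (\<A> X))\<^sup>2 \<le> (1 + \<delta>) * (norm X)\<^sup>2)" for \<delta>
  have nonneg: "0 \<le> \<delta>" if "P \<delta>" for \<delta>
  proof -
    define X :: "real ^ 'n ^ 'm" where "X = outer_prod (axis undefined 1) (axis undefined 1)"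
    have "rank X \<le> 1"
      using rank_sum_outer_prod_le[of "{()}" "\<lambda>_. axis undefined 1" "\<lambda>_. axis undefined 1"]
      by (simp add: X_def)
    then have "rank X \<le> r"
      using \<open>1 \<le> r\<close> by linarith
    then have "(1 - \<delta>) * (norm X)\<^sup>2 \<le> (1 + \<delta>) * (norm X)\<^sup>2"
      using that unfolding P_def by (blast intro: order_trans)
    moreover have "(norm X)\<^sup>2 = 1"
      by (simp add: X_def power2_norm_eq_inner inner_outer_prod inner_axis_axis)
    ultimately show ?thesis by simp
  qed
  obtain C where C: "\<And>X. norm (\<A> X) \<le> C * norm X"
    using linear_bounded[OF lin] by blast
  \<comment> \<open>A constant at least 1 makes the lower estimate trivial, and one at least
    \<open>C\<^sup>2\<close> gives the upper estimate.\<close>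
  have "P (max 1 (C\<^sup>2))"
  proof -
    have "(norm (\<A> X))\<^sup>2 \<le> C\<^sup>2 * (norm X)\<^sup>2" for X
      unfolding power_mult_distrib[symmetric] by (rule power_mono[OF C]) simp
    also have "C\<^sup>2 * (norm X)\<^sup>2 \<le> (1 + max 1 (C\<^sup>2)) * (norm X)\<^sup>2" for X :: "real ^ 'n ^ 'm"
      by (intro mult_right_mono) auto
    finally have "(norm (\<A> X))\<^sup>2 \<le> (1 + max 1 (C\<^sup>2)) * (norm X)\<^sup>2" for X .
    moreover have "(1 - max 1 (C\<^sup>2)) * (norm X)\<^sup>2 \<le> (norm (\<A> X))\<^sup>2" for X
    proof -
      have "(1 - max 1 (C\<^sup>2)) * (norm X)\<^sup>2 \<le> 0"
        by (intro mult_nonpos_nonneg) auto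
      then show ?thesis by (rule order_trans) simp
    qed
    ultimately show ?thesis by (simp add: P_def)
  qed
  moreover have bdd: "bdd_below (Collect P)"
    using nonneg by (intro bdd_belowI[of _ 0]) auto
  moreover have "closed (Collect P)"
    unfolding P_def
    by (intro closed_Collect_all closed_Collect_imp closed_Collect_conj closed_Collect_le
        continuous_intros) auto
  ultimately have "Inf (Collect P) \<in> Collect P"
    by (intro closed_contains_Inf) auto
  moreover have "(LEAST \<delta>. P \<delta>) = Inf (Collect P)"
    using calculation bdd by (intro Least_equality) (auto intro: cInf_lower)
  ultimately have "P \<delta>"
    by (simp add: \<delta>_def restricted_isometry_const_def P_def)
  then show "rank X \<le> r \<Longrightarrow> (1 - \<delta>) * (norm X)\<^sup>2 \<le> (norm (\<A> X))\<^sup>2"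
    and "rank X \<le> r \<Longrightarrow> (norm (\<A> X))\<^sup>2 \<le> (1 + \<delta>) * (norm X)\<^sup>2"
    and "0 \<le> \<delta>"
    using nonneg by (auto simp: P_def)
qed

lemma sum_consecutive_blocks:
  fixes f :: "nat \<Rightarrow> 'a::comm_monoid_add"
  shows "(\<Sum>j<J. \<Sum>i\<in>{p + j * K..<p + Suc j * K}. f i) = (\<Sum>i\<in>{p..<p + J * K}. f i)"
proof (induction J)
  case (Suc J)
  then show ?case
    using sum.atLeastLessThan_concat[of p "p + J * K" "p + Suc J * K" f] by simp
qed simp

text \<open>The value \<open>s (q + K)\<close> bounds every entry of its own block from above and
  every entry of the previous block from below.\<close>

lemma norm_block_le_sum_previous_block:
  fixes s :: "nat \<Rightarrow> real"
  assumes s0: "\<And>i. 0 \<le> s i" and dec: "\<And>i j. i \<le> j \<Longrightarrow> s j \<le> s i" and K: "0 < K"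
  shows "sqrt (\<Sum>i\<in>{q + K..<q + K + K}. (s i)\<^sup>2) \<le> (\<Sum>i\<in>{q..<q + K}. s i) / sqrt K"
proof -
  have "(\<Sum>i\<in>{q + K..<q + K + K}. (s i)\<^sup>2) \<le> (\<Sum>i\<in>{q + K..<q + K + K}. (s (q + K))\<^sup>2)"
    using s0 dec by (intro sum_mono power_mono) auto
  then have "sqrt (\<Sum>i\<in>{q + K..<q + K + K}. (s i)\<^sup>2) \<le> sqrt (K * (s (q + K))\<^sup>2)"
    by simp
  also have "\<dots> = (K * s (q + K)) / sqrt K"
    using s0 K by (simp add: real_sqrt_mult field_simps)
  also have "K * s (q + K) = (\<Sum>i\<in>{q..<q + K}. s (q + K))"
    by simp
  also have "\<dots> / sqrt K \<le> (\<Sum>i\<in>{q..<q + K}. s i) / sqrt K"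
    using dec by (intro divide_right_mono sum_mono) auto
  finally show ?thesis .
qed

text \<open>As \<open>\<A> Z = 0\<close>, the image of the head \<open>D\<close> is minus the sum of
  the images of the blocks. This squeezes \<open>(norm (\<A> D))\<^sup>2\<close> between
  \<open>1 - \<delta>'\<close> and \<open>(1 + \<delta>) * n / K\<close> times
  \<open>(norm D)\<^sup>2\<close>, which \<open>rip\<close> allows only for
  \<open>D = 0\<close>.\<close>

lemma kernel_eq_0_of_restricted_isometry:
  fixes \<A> :: "real ^ 'n ^ 'm \<Rightarrow> real ^ 'd" and Z :: "real ^ 'n ^ 'm"
  assumes lin: "linear \<A>" and Z: "\<A> Z = 0" and n: "0 < n" and K: "0 < K"
    and tail: "(\<Sum>i\<in>{n..<CARD('m)}. singular_value (Suc i) Z) \<le> (\<Sum>i<n. singular_value (Suc i) Z)"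
    and "n \<le> CARD('m)"
    and rip: "real K / real n * (1 - restricted_isometry_const \<A> (n + K))
      - (1 + restricted_isometry_const \<A> K) > 0"
  shows "Z = 0"
proof -
  define m where "m = CARD('m)"
  \<comment> \<open>Extension by zero lets the blocks run past index \<open>m\<close>.\<close>
  define s where "s i = (if i < m then singular_value (Suc i) Z else 0)" for i
  define \<delta> \<delta>' where "\<delta> = restricted_isometry_const \<A> K"
    and "\<delta>' = restricted_isometry_const \<A> (n + K)"
  have s0: "0 \<le> s i" for i
    by (simp add: s_def m_def singular_value_nonneg)
  have dec: "s j \<le> s i" if "i \<le> j" for i j
    using that singular_value_antimono[of i j Z] singular_value_nonneg[of i Z]
    by (auto simp: s_def m_def)
  obtain u :: "nat \<Rightarrow> real ^ 'm" where u: "orthonormal_seq u"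
    and uZ: "\<And>i j. i < m \<Longrightarrow> j < m \<Longrightarrow>
       (u i v* Z) \<bullet> (u j v* Z) = (if i = j then (singular_value (Suc i) Z)\<^sup>2 else 0)"
    using left_singular_basis[of Z] unfolding m_def by blast
  \<comment> \<open>The terms of the singular value decomposition of \<open>Z\<close>, with each
    singular value absorbed into \<open>u i v* Z\<close>; they are orthogonal in the Frobenius inner
    product.\<close>
  define E where "E i = (if i < m then outer_prod (u i) (u i v* Z) else 0)" for i
  define R where "R I = (\<Sum>i\<in>I. E i)" for I
  have EE: "E i \<bullet> E j = (if i = j then (s i)\<^sup>2 else 0)" for i j
  proof (cases "i < m \<and> j < m")
    case True
    then have "u i \<bullet> u j = (if i = j then 1 else 0)"
      using orthonormal_seqD[OF u] by (simp add: m_def)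
    then show ?thesis
      using True uZ[of i j] by (simp add: E_def s_def inner_outer_prod)
  qed (auto simp: E_def s_def)
  have normR: "(norm (R I))\<^sup>2 = (\<Sum>i\<in>I. (s i)\<^sup>2)" if "finite I" for I
    using norm_orthogonal_sum_sq[of I E "\<lambda>_. 1"] that by (simp add: R_def EE)
  have rankR: "rank (R I) \<le> card I" if "finite I" for I
  proof -
    have "R I = (\<Sum>i\<in>I. outer_prod (if i < m then u i else 0) (u i v* Z))"
      unfolding R_def by (intro sum.cong refl) (simp add: E_def outer_prod_def vec_eq_iff)
    then show ?thesis
      by (simp only: rank_sum_outer_prod_le[OF that])
  qed
  have RZ: "R {..<N} = Z" if "m \<le> N" for N
  proof -
    have "R {..<N} = R {..<m}"
      unfolding R_def using that by (intro sum.mono_neutral_right) (auto simp: E_def)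
    moreover have "x v* R {..<m} = x v* Z" for x
    proof -
      have "x v* R {..<m} = (\<Sum>i<m. (u i \<bullet> x) *\<^sub>R (u i v* Z))"
        by (simp add: R_def E_def vector_matrix_mult_sum_right vector_matrix_mult_outer_prod)
      also have "\<dots> = (\<Sum>i<DIM(real^'m). (u i \<bullet> x) *\<^sub>R u i) v* Z"
        by (simp add: m_def linear_sum[OF linear_vector_matrix_mult]
            linear_cmul[OF linear_vector_matrix_mult])
      finally show ?thesis by (simp only: orthonormal_seq_expand[OF u])
    qed
    ultimately show ?thesis by (simp add: matrix_eq_vector_matrix_mult)
  qed
  define D where "D = R {..<n + K}"
  \<comment> \<open>Blocks start after the head, and \<open>m\<close> of them suffice to exhaust the
    indices because \<open>K > 0\<close>.\<close>
  define block where "block j = {n + K + j * K..<n + K + Suc j * K}" for j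
  have "\<delta> \<ge> 0"
    using restricted_isometry_const_bounds(3)[OF lin, of K] K by (simp add: \<delta>_def)
  have "Z = D + (\<Sum>j<m. R (block j))"
  proof -
    have "m \<le> m * K" using K by simp
    then have "Z = R {..<n + K + m * K}"
      by (intro RZ[symmetric]) linarith
    also have "\<dots> = R {0..<n + K} + R {n + K..<n + K + m * K}"
      unfolding R_def lessThan_atLeast0 by (intro sum.atLeastLessThan_concat[symmetric]) auto
    also have "R {n + K..<n + K + m * K} = (\<Sum>j<m. R (block j))"
      unfolding R_def block_def by (rule sum_consecutive_blocks[symmetric])
    finally show ?thesis by (simp add: D_def lessThan_atLeast0)
  qed
  then have "\<A> D + (\<Sum>j<m. \<A> (R (block j))) = 0"
    using Z by (simp add: linear_add[OF lin] linear_sum[OF lin])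
  then have "\<A> D = - (\<Sum>j<m. \<A> (R (block j)))"
    by (rule eq_neg_iff_add_eq_0[THEN iffD2])
  then have "norm (\<A> D) = norm (\<Sum>j<m. \<A> (R (block j)))"
    by simp
  also have "\<dots> \<le> (\<Sum>j<m. norm (\<A> (R (block j))))"
    by (rule norm_sum)
  \<comment> \<open>Each block is charged to the \<open>K\<close> indices before it. For the first
    block these are the last \<open>K\<close> indices of the head, so the charges add up to the sum
    of \<open>s\<close> from \<open>n\<close> on.\<close>
  also have "\<dots> \<le> (\<Sum>j<m. sqrt (1 + \<delta>) * ((\<Sum>i\<in>{n + j * K..<n + Suc j * K}. s i) / sqrt K))"
  proof (rule sum_mono)
    fix j
    have "rank (R (block j)) \<le> K"
      using rankR[of "block j"] by (simp add: block_def)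
    then have "(norm (\<A> (R (block j))))\<^sup>2 \<le> (1 + \<delta>) * (norm (R (block j)))\<^sup>2"
      using restricted_isometry_const_bounds(2)[OF lin, of K] K by (simp add: \<delta>_def)
    then have "norm (\<A> (R (block j))) \<le> sqrt ((1 + \<delta>) * (norm (R (block j)))\<^sup>2)"
      by (rule real_le_rsqrt)
    also have "\<dots> = sqrt (1 + \<delta>) * sqrt (\<Sum>i\<in>block j. (s i)\<^sup>2)"
      by (simp add: real_sqrt_mult normR block_def)
    also have "\<dots> \<le> sqrt (1 + \<delta>) * ((\<Sum>i\<in>{n + j * K..<n + Suc j * K}. s i) / sqrt K)"
    proof (rule mult_left_mono)
      show "sqrt (\<Sum>i\<in>block j. (s i)\<^sup>2) \<le> (\<Sum>i\<in>{n + j * K..<n + Suc j * K}. s i) / sqrt K"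
        using norm_block_le_sum_previous_block[of s K "n + j * K", OF s0 dec K]
        by (simp add: block_def add_ac)
    qed (use \<open>\<delta> \<ge> 0\<close> in simp)
    finally show "norm (\<A> (R (block j)))
      \<le> sqrt (1 + \<delta>) * ((\<Sum>i\<in>{n + j * K..<n + Suc j * K}. s i) / sqrt K)" .
  qed
  also have "\<dots> = sqrt (1 + \<delta>) * ((\<Sum>i\<in>{n..<n + m * K}. s i) / sqrt K)"
    by (simp only: sum_consecutive_blocks flip: sum_distrib_left sum_divide_distrib)
  \<comment> \<open>The hypothesis \<open>tail\<close> replaces this sum by the one over the first
    \<open>n\<close> indices, and Cauchy-Schwarz bounds that by
    \<open>sqrt n * norm D\<close>.\<close>
  also have "\<dots> \<le> sqrt (1 + \<delta>) * ((sqrt n * norm D) / sqrt K)"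
  proof (intro mult_left_mono divide_right_mono)
    have "(\<Sum>i\<in>{n..<n + m * K}. s i) = (\<Sum>i\<in>{n..<m}. s i)"
    proof (rule sum.mono_neutral_right)
      have "m \<le> m * K" using K by simp
      then have "m \<le> n + m * K" by linarith
      then show "{n..<m} \<subseteq> {n..<n + m * K}" by auto
    qed (auto simp: s_def)
    also have "\<dots> \<le> (\<Sum>i<n. s i)"
      using tail \<open>n \<le> CARD('m)\<close> by (simp add: s_def m_def)
    also have "\<dots> \<le> sqrt n * sqrt (\<Sum>i<n. (s i)\<^sup>2)"
      using L2_set_mult_ineq[of "\<lambda>_. 1" s "{..<n}"] s0 by (simp add: L2_set_def)
    also have "\<dots> \<le> sqrt n * norm D"
    proof (intro mult_left_mono)
      have "(\<Sum>i<n. (s i)\<^sup>2) \<le> (norm D)\<^sup>2"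
        unfolding D_def by (subst normR) (auto intro!: sum_mono2)
      then show "sqrt (\<Sum>i<n. (s i)\<^sup>2) \<le> norm D"
        by (intro real_le_lsqrt) auto
    qed simp
    finally show "(\<Sum>i\<in>{n..<n + m * K}. s i) \<le> sqrt n * norm D" .
  qed (use \<open>\<delta> \<ge> 0\<close> in auto)
  finally have "(norm (\<A> D))\<^sup>2 \<le> (sqrt (1 + \<delta>) * ((sqrt n * norm D) / sqrt K))\<^sup>2"
    by (intro power_mono) auto
  also have "\<dots> = (1 + \<delta>) * n / K * (norm D)\<^sup>2"
    using \<open>\<delta> \<ge> 0\<close> by (simp add: power_mult_distrib power_divide)
  finally have "(norm (\<A> D))\<^sup>2 \<le> (1 + \<delta>) * n / K * (norm D)\<^sup>2" .
  moreover have "(1 - \<delta>') * (norm D)\<^sup>2 \<le> (norm (\<A> D))\<^sup>2"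
    using restricted_isometry_const_bounds(1)[OF lin, of "n + K" D] K rankR[of "{..<n + K}"]
    by (simp add: \<delta>'_def D_def)
  ultimately have le: "(1 - \<delta>') * (norm D)\<^sup>2 \<le> (1 + \<delta>) * n / K * (norm D)\<^sup>2"
    by linarith
  have "norm D = 0"
  proof (rule ccontr)
    assume "norm D \<noteq> 0"
    then have "1 - \<delta>' \<le> (1 + \<delta>) * n / K"
      using mult_right_le_imp_le[OF le] by simp
    then have "K / n * (1 - \<delta>') \<le> K / n * ((1 + \<delta>) * n / K)"
      by (intro mult_left_mono) auto
    also have "\<dots> = 1 + \<delta>"
      using n K by simp
    finally show False
      using rip by (simp add: \<delta>_def \<delta>'_def)
  qed
  then have "(\<Sum>i<n + K. (s i)\<^sup>2) = 0"
    using normR[of "{..<n + K}"] by (simp add: D_def)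
  \<comment> \<open>The largest singular value belongs to the head, so a vanishing head forces all
    of them to vanish.\<close>
  then have "s 0 = 0"
    using n by (subst (asm) sum_nonneg_eq_0_iff) auto
  then have "s i = 0" for i
    using dec[of 0 i] s0[of i] by simp
  then have "norm Z = 0"
    using normR[of "{..<m}"] RZ[of m] by simp
  then show ?thesis by simp
qed

theorem theorem3:
  fixes T K :: nat
  assumes "CARD('m::finite) \<le> CARD('n::finite)"
    and "T \<ge> 1" and "K > 2 * T" and "2 * T + K \<le> CARD('m)"
  shows "\<exists>astar :: real \<Rightarrow> real \<Rightarrow> real.
    \<forall>(\<A> :: real ^ 'n ^ 'm \<Rightarrow> real ^ 'd::finite) (b :: real ^ 'd) (X\<^sub>0 :: real ^ 'n ^ 'm).
      linear \<A> \<longrightarrow>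
      is_arg_min rank (\<lambda>X. \<A> X = b) X\<^sub>0 \<longrightarrow>
      rank X\<^sub>0 = T \<longrightarrow>
      real K / (2 * real T) * (1 - restricted_isometry_const \<A> (2 * T + K))
        - (1 + restricted_isometry_const \<A> K) > 0 \<longrightarrow>
      astar (restricted_isometry_const \<A> K) (restricted_isometry_const \<A> (2 * T + K)) > 1 \<and>
      (\<forall>a. 1 < a \<and>
           a < astar (restricted_isometry_const \<A> K) (restricted_isometry_const \<A> (2 * T + K)) \<longrightarrow>
        (\<forall>Xstar. is_arg_min (frac_penalty a) (\<lambda>X. \<A> X = b) Xstar \<longrightarrow> Xstar = X\<^sub>0))"
proof -
  have recovery: "Xstar = X\<^sub>0"
    if lin: "linear \<A>" and X0: "is_arg_min rank (\<lambda>X. \<A> X = b) X\<^sub>0" "rank X\<^sub>0 = T"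
      and rip: "real K / (2 * real T) * (1 - restricted_isometry_const \<A> (2 * T + K))
        - (1 + restricted_isometry_const \<A> K) > 0"
      and a: "1 < a" and Xstar: "is_arg_min (frac_penalty a) (\<lambda>X. \<A> X = b) Xstar"
    for \<A> :: "real ^ 'n ^ 'm \<Rightarrow> real ^ 'd" and b X\<^sub>0 Xstar a
  proof -
    define Z where "Z = Xstar - X\<^sub>0"
    have AZ: "\<A> Z = 0"
      using X0(1) Xstar by (simp add: Z_def is_arg_min_def linear_diff[OF lin])
    have le: "frac_penalty a (X\<^sub>0 + Z) \<le> frac_penalty a X\<^sub>0"
      using X0(1) Xstar by (auto simp: Z_def is_arg_min_def not_less)
    have "0 \<le> a" "2 * rank X\<^sub>0 \<le> CARD('m)"
      using a assms(4) X0(2) by auto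
    from frac_null_space_property[OF this le]
    have "(\<Sum>i\<in>{2 * T..<CARD('m)}. a * singular_value (Suc i) Z / (a * singular_value (Suc i) Z + 1))
        \<le> (\<Sum>i<T. a * singular_value (Suc i) Z / (a * singular_value (Suc i) Z + 1))"
      by (simp only: X0(2))
    \<comment> \<open>The right-hand sum is enlarged so that both sides meet at the cut
      \<open>2 * T\<close>, where the chord comparison applies.\<close>
    also have "\<dots> \<le> (\<Sum>i<2 * T. a * singular_value (Suc i) Z / (a * singular_value (Suc i) Z + 1))"
    proof (rule sum_mono2)
      fix i assume "i \<in> {..<2 * T} - {..<T}"
      then have "0 \<le> singular_value (Suc i) Z"
        using assms(4) by (intro singular_value_nonneg) simp
      then show "0 \<le> a * singular_value (Suc i) Z / (a * singular_value (Suc i) Z + 1)"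
        using a by simp
    qed auto
    finally have "(\<Sum>i\<in>{2 * T..<CARD('m)}. singular_value (Suc i) Z)
        \<le> (\<Sum>i<2 * T. singular_value (Suc i) Z)"
      by (rule sum_tail_le_of_frac[rotated 4])
         (use a assms(4) in \<open>simp_all add: singular_value_nonneg singular_value_antimono\<close>)
    moreover have "0 < 2 * T" "0 < K" "2 * T \<le> CARD('m)"
      using assms(2-4) by auto
    moreover have "real K / real (2 * T) * (1 - restricted_isometry_const \<A> (2 * T + K))
        - (1 + restricted_isometry_const \<A> K) > 0"
      using rip by simp
    ultimately have "Z = 0"
      using kernel_eq_0_of_restricted_isometry[OF lin AZ] by blast
    then show ?thesis by (simp add: Z_def)
  qed
  show ?thesis
  \<comment> \<open>Recovery holds for every \<open>a > 1\<close>, so a constant threshold function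
    serves all values of the two isometry constants.\<close>
  proof (intro exI[of _ "\<lambda>_ _. 2"] allI impI conjI)
    show "(1::real) < 2" by simp
  next
    fix \<A> :: "real ^ 'n ^ 'm \<Rightarrow> real ^ 'd" and b X\<^sub>0 Xstar and a :: real
    assume "linear \<A>" "is_arg_min rank (\<lambda>X. \<A> X = b) X\<^sub>0" "rank X\<^sub>0 = T"
      "real K / (2 * real T) * (1 - restricted_isometry_const \<A> (2 * T + K))
        - (1 + restricted_isometry_const \<A> K) > 0"
      "1 < a \<and> a < 2" "is_arg_min (frac_penalty a) (\<lambda>X. \<A> X = b) Xstar"
    then show "Xstar = X\<^sub>0"
      by (elim conjE) (rule recovery)
  qed
qed

end
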